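(* Let $B$ be a finite perfect two-sided skew brace. Then $$B/Z(B)\simeq \operatorname{Triv}(G)\times\operatorname{aTriv}(H)$$ (as skew braces) for some finite perfect groups $G$ and $H$.
   Context: A skew brace is a triple $(B,+,\cdot)$ such that $(B,+)$ and $(B,\cdot)$ are groups (neither assumed abelian) and $a\cdot(b+c)=a\cdot b-a+a\cdot c$ for all $a,b,c\in B$; both groups have the same identity, denoted $0$. It is two-sided if moreover $(a+b)c=ac-c+bc$ for all $a,b,c\in B$. An isomorphism of skew braces is a bijection that is a homomorphism for both operations; the direct product of skew braces has componentwise operations. For $b\in B$ put $\lambda_b(a)=-b+ba$. A subset $I\subseteq B$ is an ideal if $(I,+)\trianglelefteq(B,+)$, $(I,\cdot)\trianglelefteq(B,\cdot)$ and $\lambda_b(I)\subseteq I$ for all $b\in B$; then $a+I=aI$ for all $a\in B$ and $B/I$ is a skew brace. The center $Z(B)$ is the set of $z\in B$ that are central in both $(B,+)$ and $(B,\cdot)$ and satisfy $\lambda_z=\operatorname{id}_B$; it is an ideal. The commutator ideal $[B,B]^B$ is the ideal of $B$ generated by the additive commutators, the multiplicative commutators and the elements $ab-(a+b)$, $a,b\in B$. The skew brace $B$ is perfect if $B=[B,B]^B$. A group is perfect if it equals its derived subgroup (the trivial group is perfect). For a group $(G,\cdot)$, $\operatorname{Triv}(G)=(G,\cdot,\cdot)$ is the skew brace in which both operations equal the group operation, and $\operatorname{aTriv}(G)=(G,\cdot^{\operatorname{op}},\cdot)$ is the skew brace whose additive operation is the opposite operation $a\cdot^{\operatorname{op}}b=b\cdot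 a$ and whose multiplicative operation is $\cdot$. *)

theory Defs
  imports "HOL-Algebra.Chinese_Remainder" "HOL-Algebra.Generated_Groups"
begin

text \<open>
  A skew brace is carried by a \<open>ring\<close> record, which provides a carrier with two binary
  operations; none of the ring axioms is assumed.  The library's ring homomorphisms, the
  isomorphism relation \<open>\<simeq>\<close>, the direct product \<^const>\<open>RDirProd\<close> and the quotient \<open>Quot\<close> are
  definitions on bare records, so they apply as they stand.
\<close>

locale skew_brace = add: group "add_monoid B" + group B for B (structure) +
  assumes skew_left_distrib:
    "\<lbrakk>a \<in> carrier B; b \<in> carrier B; c \<in> carrier B\<rbrakk>
      \<Longrightarrow> a \<otimes> (b \<oplus> c) = (a \<otimes> b \<ominus> a) \<oplus> a \<otimes> c"

locale two_sided_skew_brace = skew_brace +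
  assumes skew_right_distrib:
    "\<lbrakk>a \<in> carrier B; b \<in> carrier B; c \<in> carrier B\<rbrakk>
      \<Longrightarrow> (a \<oplus> b) \<otimes> c = (a \<otimes> c \<ominus> c) \<oplus> b \<otimes> c"

lemma (in skew_brace) zero_eq_one: "\<zero> = \<one>"
proof -
  have z: "\<zero> \<in> carrier B"
    using add.one_closed by simp
  have i: "\<ominus> \<one> \<in> carrier B"
    using add.inv_closed[of \<one>] by (simp add: a_inv_def)
  have "\<one> \<otimes> (\<zero> \<oplus> \<zero>) = (\<one> \<otimes> \<zero> \<ominus> \<one>) \<oplus> \<one> \<otimes> \<zero>"
    by (rule skew_left_distrib) (use z in auto)
  then have "\<zero> = \<ominus> \<one>"
    using z i add.l_one[of \<zero>] add.l_one[of "\<ominus> \<one>"] add.r_one[of "\<ominus> \<one>"]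
    by (simp add: a_minus_def)
  then show ?thesis
    using add.r_inv[of \<one>] add.r_one[of \<one>] by (simp add: a_inv_def)
qed

definition sb_lambda :: "('a, 'm) ring_scheme \<Rightarrow> 'a \<Rightarrow> 'a \<Rightarrow> 'a"
  where "sb_lambda B b a = \<ominus>\<^bsub>B\<^esub> b \<oplus>\<^bsub>B\<^esub> (b \<otimes>\<^bsub>B\<^esub> a)"

definition sb_ideal :: "'a set \<Rightarrow> ('a, 'm) ring_scheme \<Rightarrow> bool"
  where "sb_ideal I B \<longleftrightarrow> I \<lhd> add_monoid B \<and> I \<lhd> B \<and>
    (\<forall>b \<in> carrier B. sb_lambda B b ` I \<subseteq> I)"

definition sb_center :: "('a, 'm) ring_scheme \<Rightarrow> 'a set"
  where "sb_center B = {z \<in> carrier B. \<forall>a \<in> carrier B.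
    z \<oplus>\<^bsub>B\<^esub> a = a \<oplus>\<^bsub>B\<^esub> z \<and> z \<otimes>\<^bsub>B\<^esub> a = a \<otimes>\<^bsub>B\<^esub> z \<and> sb_lambda B z a = a}"

definition sb_genideal :: "('a, 'm) ring_scheme \<Rightarrow> 'a set \<Rightarrow> 'a set"
  where "sb_genideal B S = \<Inter>{I. sb_ideal I B \<and> S \<subseteq> I}"

text \<open>
  \<^const>\<open>derived_set\<close> is the set of commutators \<open>x y x\<inverse> y\<inverse>\<close>, not the subgroup they generate.
\<close>

definition sb_commutator_ideal :: "('a, 'm) ring_scheme \<Rightarrow> 'a set"
  where "sb_commutator_ideal B = sb_genideal B
    (derived_set (add_monoid B) (carrier B) \<union> derived_set B (carrier B) \<union>
     {(a \<otimes>\<^bsub>B\<^esub> b) \<ominus>\<^bsub>B\<^esub> (a \<oplus>\<^bsub>B\<^esub> b) | a b. a \<in> carrier B \<and> b \<in> carrier B})"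

definition sb_perfect :: "('a, 'm) ring_scheme \<Rightarrow> bool"
  where "sb_perfect B \<longleftrightarrow> sb_commutator_ideal B = carrier B"

definition perfect_group :: "('a, 'm) monoid_scheme \<Rightarrow> bool"
  where "perfect_group G \<longleftrightarrow> group G \<and> derived G (carrier G) = carrier G"

definition Triv :: "('a, 'm) monoid_scheme \<Rightarrow> 'a ring"
  where "Triv G = \<lparr>carrier = carrier G, mult = mult G, one = one G,
    zero = one G, add = mult G\<rparr>"

definition aTriv :: "('a, 'm) monoid_scheme \<Rightarrow> 'a ring"
  where "aTriv G = \<lparr>carrier = carrier G, mult = mult G, one = one G,
    zero = one G, add = (\<lambda>a b. b \<otimes>\<^bsub>G\<^esub> a)\<rparr>"

end

theory Submission
  imports Defs
begin

text \<open>
  Write \<open>a \<star> b = - a + a b - b\<close> and \<open>a \<diamondop> b = - b + a b - a\<close>.  Expanding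
  \<open>(x + y) \<star> (a + b)\<close> in two ways shows that every \<open>x \<star> b\<close> commutes additively with every
  \<open>y \<diamondop> a\<close>.  Hence the additive centralizer \<open>I\<close> of the elements \<open>y \<diamondop> a\<close> is an ideal
  containing all \<open>x \<star> b\<close>, the centralizer \<open>J\<close> of the elements \<open>x \<star> b\<close> is an ideal containing
  all \<open>y \<diamondop> a\<close>, and perfectness gives \<open>I + J = B\<close> and \<open>I \<inter> J = Z(B,+)\<close>.  So \<open>B / Z(B,+)\<close> is
  the product of \<open>B / I\<close>, where the two operations agree, and \<open>B / J\<close>, where they are opposite.

  It remains to see that \<open>Z(B,+)\<close> is the center of \<open>B\<close>.  The elements of \<open>B\<close> that act trivially
  on \<open>Z(B,+)\<close> by \<open>\<star>\<close>, from the left or from the right, form an ideal with an additively abelian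
  quotient.  By finiteness such a quotient is like a nilpotent ring (Nakayama), and as it is
  perfect it vanishes.
\<close>

section \<open>Arithmetic in a skew brace and its star operations\<close>

context skew_brace
begin

lemma a_closed [simp]: "\<lbrakk>x \<in> carrier B; y \<in> carrier B\<rbrakk> \<Longrightarrow> x \<oplus> y \<in> carrier B"
  using add.m_closed by simp

lemma zero_closed [simp]: "\<zero> \<in> carrier B"
  using add.one_closed by simp

lemma a_inv_closed [simp]: "x \<in> carrier B \<Longrightarrow> \<ominus> x \<in> carrier B"
  using add.inv_closed by (simp add: a_inv_def)

lemma a_assoc [simp]:
  "\<lbrakk>x \<in> carrier B; y \<in> carrier B; z \<in> carrier B\<rbrakk> \<Longrightarrow> x \<oplus> y \<oplus> z = x \<oplus> (y \<oplus> z)"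
  using add.m_assoc by simp

lemma l_zero [simp]: "x \<in> carrier B \<Longrightarrow> \<zero> \<oplus> x = x"
  using add.l_one by simp

lemma r_zero [simp]: "x \<in> carrier B \<Longrightarrow> x \<oplus> \<zero> = x"
  using add.r_one by simp

lemma l_neg [simp]: "x \<in> carrier B \<Longrightarrow> \<ominus> x \<oplus> x = \<zero>"
  using add.l_inv by (simp add: a_inv_def)

lemma r_neg [simp]: "x \<in> carrier B \<Longrightarrow> x \<oplus> \<ominus> x = \<zero>"
  using add.r_inv by (simp add: a_inv_def)

lemma l_neg_cancel [simp]: "\<lbrakk>x \<in> carrier B; y \<in> carrier B\<rbrakk> \<Longrightarrow> \<ominus> x \<oplus> (x \<oplus> y) = y"
  by (simp flip: a_assoc)

lemma r_neg_cancel [simp]: "\<lbrakk>x \<in> carrier B; y \<in> carrier B\<rbrakk> \<Longrightarrow> x \<oplus> (\<ominus> x \<oplus> y) = y"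
  by (simp flip: a_assoc)

lemma a_inv_inv [simp]: "x \<in> carrier B \<Longrightarrow> \<ominus> (\<ominus> x) = x"
  using add.inv_inv by (simp add: a_inv_def)

lemma a_inv_zero [simp]: "\<ominus> \<zero> = \<zero>"
  using add.inv_one by (simp add: a_inv_def)

lemma a_inv_add [simp]:
  "\<lbrakk>x \<in> carrier B; y \<in> carrier B\<rbrakk> \<Longrightarrow> \<ominus> (x \<oplus> y) = \<ominus> y \<oplus> \<ominus> x"
  using add.inv_mult_group by (simp add: a_inv_def)

lemma add_left_cancel [simp]:
  "\<lbrakk>x \<in> carrier B; y \<in> carrier B; z \<in> carrier B\<rbrakk> \<Longrightarrow> x \<oplus> y = x \<oplus> z \<longleftrightarrow> y = z"
  by (metis l_neg_cancel)

lemma add_right_cancel [simp]: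
  "\<lbrakk>x \<in> carrier B; y \<in> carrier B; z \<in> carrier B\<rbrakk> \<Longrightarrow> y \<oplus> x = z \<oplus> x \<longleftrightarrow> y = z"
  by (metis a_assoc a_inv_closed r_neg r_zero)

lemma a_minus_eq [simp]: "x \<ominus> y = x \<oplus> \<ominus> y"
  by (simp add: a_minus_def)

lemma mult_zero [simp]: "x \<in> carrier B \<Longrightarrow> x \<otimes> \<zero> = x"
  by (simp add: zero_eq_one)

lemma zero_mult [simp]: "x \<in> carrier B \<Longrightarrow> \<zero> \<otimes> x = x"
  by (simp add: zero_eq_one)

text \<open>The deviation of the product from the sum. For a radical ring with its adjoint operation
  as product, this is the ring multiplication, and it plays that role throughout.\<close>

definition star (infixl \<open>\<star>\<close> 75) where "a \<star> b = \<ominus> a \<oplus> (a \<otimes> b \<oplus> \<ominus> b)"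

text \<open>The operation \<open>\<star>\<close> of the skew brace with the opposite addition.\<close>

definition ostar (infixl \<open>\<diamondop>\<close> 75) where "a \<diamondop> b = \<ominus> b \<oplus> (a \<otimes> b \<oplus> \<ominus> a)"

lemma star_closed [simp]: "\<lbrakk>a \<in> carrier B; b \<in> carrier B\<rbrakk> \<Longrightarrow> a \<star> b \<in> carrier B"
  by (simp add: star_def)

lemma ostar_closed [simp]: "\<lbrakk>a \<in> carrier B; b \<in> carrier B\<rbrakk> \<Longrightarrow> a \<diamondop> b \<in> carrier B"
  by (simp add: ostar_def)

lemma mult_eq: "\<lbrakk>a \<in> carrier B; b \<in> carrier B\<rbrakk> \<Longrightarrow> a \<otimes> b = a \<oplus> (a \<star> b \<oplus> b)"
  by (simp add: star_def)

lemma ostar_eq: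
  "\<lbrakk>a \<in> carrier B; b \<in> carrier B\<rbrakk> \<Longrightarrow> a \<diamondop> b = \<ominus> b \<oplus> (a \<oplus> (a \<star> b \<oplus> (b \<oplus> \<ominus> a)))"
  by (simp add: star_def ostar_def)

lemma lambda_eq: "\<lbrakk>a \<in> carrier B; b \<in> carrier B\<rbrakk> \<Longrightarrow> sb_lambda B a b = a \<star> b \<oplus> b"
  by (simp add: sb_lambda_def star_def)

lemma star_zero [simp]: "a \<in> carrier B \<Longrightarrow> a \<star> \<zero> = \<zero>"
  by (simp add: star_def)

lemma zero_star [simp]: "a \<in> carrier B \<Longrightarrow> \<zero> \<star> a = \<zero>"
  by (simp add: star_def)

lemma star_add_right:
  assumes "a \<in> carrier B" "b \<in> carrier B" "c \<in> carrier B"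
  shows "a \<star> (b \<oplus> c) = a \<star> b \<oplus> (b \<oplus> (a \<star> c \<oplus> \<ominus> b))"
  using assms skew_left_distrib[of a b c] by (simp add: star_def)

lemma ostar_add_right:
  assumes "a \<in> carrier B" "b \<in> carrier B" "c \<in> carrier B"
  shows "a \<diamondop> (b \<oplus> c) = \<ominus> c \<oplus> (a \<diamondop> b \<oplus> (c \<oplus> a \<diamondop> c))"
  using assms skew_left_distrib[of a b c] by (simp add: ostar_def)

text \<open>Associativity of the product makes \<open>sb_lambda\<close> an action of the
  multiplicative group; this is that fact rewritten in terms of \<open>\<star>\<close>.\<close>

lemma star_mult_left:
  assumes [simp]: "a \<in> carrier B" "b \<in> carrier B" "c \<in> carrier B"
  shows "(a \<otimes> b) \<star> c = a \<star> (b \<star> c) \<oplus> (b \<star> c \<oplus> a \<star> c)"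
proof -
  have "(a \<otimes> b) \<otimes> c = a \<otimes> (b \<otimes> c)"
    by (simp add: m_assoc)
  then have "a \<otimes> b \<oplus> ((a \<otimes> b) \<star> c \<oplus> c) = a \<oplus> (a \<star> (b \<oplus> (b \<star> c \<oplus> c)) \<oplus> (b \<oplus> (b \<star> c \<oplus> c)))"
    using mult_eq[of "a \<otimes> b" c] mult_eq[of a "b \<otimes> c"] mult_eq[of b c] by simp
  then have "(a \<otimes> b) \<star> c \<oplus> c = (a \<star> (b \<star> c) \<oplus> (b \<star> c \<oplus> a \<star> c)) \<oplus> c"
    using mult_eq[of a b] by (simp add: star_add_right)
  then show ?thesis
    by (simp del: a_assoc)
qed

end

subsection \<open>Two-sided skew braces and their ideals\<close>

context two_sided_skew_brace
begin

lemma star_add_left: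
  assumes "a \<in> carrier B" "b \<in> carrier B" "c \<in> carrier B"
  shows "(a \<oplus> b) \<star> c = \<ominus> b \<oplus> (a \<star> c \<oplus> (b \<oplus> b \<star> c))"
  using assms skew_right_distrib[of a b c] by (simp add: star_def)

text \<open>Expand \<open>(x + y) \<star> (a + b)\<close> by the two distributive laws in either order.\<close>

lemma star_ostar_commute:
  assumes [simp]: "x \<in> carrier B" "b \<in> carrier B" "y \<in> carrier B" "a \<in> carrier B"
  shows "x \<star> b \<oplus> y \<diamondop> a = y \<diamondop> a \<oplus> x \<star> b"
proof -
  let ?s = "x \<star> b" and ?t = "y \<star> a"
  \<comment> \<open>\<open>?w\<close> is the tail shared by the two expansions. Once it is
    cancelled, adding \<open>\<ominus> a\<close> on the left and \<open>\<ominus> y\<close> on the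
    right completes \<open>y \<diamondop> a\<close> on both sides.\<close>
  let ?w = "y \<star> b \<oplus> \<ominus> a"
  have "(y \<oplus> (?t \<oplus> (a \<oplus> (\<ominus> y \<oplus> (?s \<oplus> y))))) \<oplus> ?w
      = (a \<oplus> (?s \<oplus> (\<ominus> a \<oplus> (y \<oplus> (?t \<oplus> a))))) \<oplus> ?w"
    using star_add_left[of x y "a \<oplus> b"] star_add_right[of "x \<oplus> y" a b]
    by (simp add: star_add_right star_add_left)
  then have "y \<oplus> (?t \<oplus> (a \<oplus> (\<ominus> y \<oplus> (?s \<oplus> y)))) = a \<oplus> (?s \<oplus> (\<ominus> a \<oplus> (y \<oplus> (?t \<oplus> a))))"
    by (subst (asm) add_right_cancel) simp_all
  then have "\<ominus> a \<oplus> ((y \<oplus> (?t \<oplus> (a \<oplus> (\<ominus> y \<oplus> (?s \<oplus> y))))) \<oplus> \<ominus> y)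
      = \<ominus> a \<oplus> ((a \<oplus> (?s \<oplus> (\<ominus> a \<oplus> (y \<oplus> (?t \<oplus> a))))) \<oplus> \<ominus> y)"
    by (rule arg_cong)
  then show ?thesis
    by (simp add: ostar_eq)
qed

text \<open>The right-handed counterpart of \<open>sb_lambda\<close>: right distributivity makes it
  additive in \<open>x\<close>, and \<open>rho (inv c)\<close> inverts it.\<close>

definition rho where "rho c x = x \<otimes> c \<ominus> c"

lemma rho_closed [simp]: "\<lbrakk>c \<in> carrier B; x \<in> carrier B\<rbrakk> \<Longrightarrow> rho c x \<in> carrier B"
  by (simp add: rho_def)

lemma lambda_closed [simp]: "\<lbrakk>c \<in> carrier B; x \<in> carrier B\<rbrakk> \<Longrightarrow> sb_lambda B c x \<in> carrier B"
  by (simp add: sb_lambda_def)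

lemma rho_eq: "\<lbrakk>c \<in> carrier B; x \<in> carrier B\<rbrakk> \<Longrightarrow> rho c x = x \<oplus> x \<star> c"
  by (simp add: rho_def star_def)

lemma lambda_add:
  "\<lbrakk>c \<in> carrier B; x \<in> carrier B; y \<in> carrier B\<rbrakk>
    \<Longrightarrow> sb_lambda B c (x \<oplus> y) = sb_lambda B c x \<oplus> sb_lambda B c y"
  by (simp add: lambda_eq star_add_right)

lemma rho_add:
  "\<lbrakk>c \<in> carrier B; x \<in> carrier B; y \<in> carrier B\<rbrakk> \<Longrightarrow> rho c (x \<oplus> y) = rho c x \<oplus> rho c y"
  by (simp add: rho_eq star_add_left)

lemma lambda_lambda_inv:
  assumes [simp]: "c \<in> carrier B" "x \<in> carrier B"
  shows "sb_lambda B c (sb_lambda B (inv c) x) = x"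
proof -
  have "c \<star> (inv c \<star> x) \<oplus> (inv c \<star> x \<oplus> c \<star> x) \<oplus> x = (c \<otimes> inv c) \<star> x \<oplus> x"
    by (subst star_mult_left) simp_all
  also have "\<dots> = x"
    by (simp flip: zero_eq_one)
  finally show ?thesis
    by (simp add: lambda_eq star_add_right)
qed

text \<open>Apply the additive map \<open>rho b\<close> to the equation
  \<open>rho a x \<oplus> a = x \<otimes> a\<close>.\<close>

lemma rho_mult:
  assumes [simp]: "a \<in> carrier B" "b \<in> carrier B" "x \<in> carrier B"
  shows "rho b (rho a x) = rho (a \<otimes> b) x"
proof -
  have "rho b (rho a x \<oplus> a) = rho b (rho a x) \<oplus> rho b a"
    by (simp add: rho_add)
  then have "x \<otimes> a \<otimes> b \<oplus> \<ominus> b = (rho b (rho a x) \<oplus> a \<otimes> b) \<oplus> \<ominus> b"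
    by (simp add: rho_def)
  then have "x \<otimes> a \<otimes> b = rho b (rho a x) \<oplus> a \<otimes> b"
    by (subst (asm) add_right_cancel) simp_all
  then show ?thesis
    by (simp add: rho_def m_assoc)
qed

lemma rho_rho_inv:
  "\<lbrakk>c \<in> carrier B; x \<in> carrier B\<rbrakk> \<Longrightarrow> rho c (rho (inv c) x) = x"
  by (simp add: rho_mult) (simp add: rho_eq flip: zero_eq_one)

section \<open>Ideals, their cosets, and perfectness as a criterion for an ideal to be
  everything\<close>

lemma add_mult_inv:
  "\<lbrakk>x \<in> carrier B; c \<in> carrier B\<rbrakk> \<Longrightarrow> (x \<oplus> c) \<otimes> inv c = x \<oplus> x \<star> inv c"
  using skew_right_distrib[of x c "inv c"] by (simp add: star_def zero_eq_one[symmetric])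

text \<open>A ring-like criterion: a normal additive subgroup absorbing \<open>\<star>\<close> on
  both sides. The multiplicative conditions are recovered from it.\<close>

lemma sb_idealI:
  assumes sub: "J \<subseteq> carrier B" and zero: "\<zero> \<in> J"
    and add: "\<And>x y. \<lbrakk>x \<in> J; y \<in> J\<rbrakk> \<Longrightarrow> x \<oplus> y \<in> J"
    and neg: "\<And>x. x \<in> J \<Longrightarrow> \<ominus> x \<in> J"
    and conj: "\<And>c x. \<lbrakk>c \<in> carrier B; x \<in> J\<rbrakk> \<Longrightarrow> c \<oplus> (x \<oplus> \<ominus> c) \<in> J"
    and left: "\<And>c x. \<lbrakk>c \<in> carrier B; x \<in> J\<rbrakk> \<Longrightarrow> c \<star> x \<in> J"
    and right: "\<And>c x. \<lbrakk>c \<in> carrier B; x \<in> J\<rbrakk> \<Longrightarrow> x \<star> c \<in> J"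
  shows "sb_ideal J B"
proof -
  have mem [simp]: "x \<in> carrier B" if "x \<in> J" for x
    using that sub by blast
  have "subgroup J (add_monoid B)"
    using sub zero add neg by (intro add.subgroupI) (auto simp flip: a_inv_def)
  moreover have "x \<oplus> h \<oplus> \<ominus> x \<in> J" if "x \<in> carrier B" "h \<in> J" for x h
    using conj[OF that] that by simp
  ultimately have 1: "J \<lhd> add_monoid B"
    by (simp add: add.normal_inv_iff flip: a_inv_def)
  \<comment> \<open>Solving \<open>inv x \<otimes> x = \<zero>\<close> for \<open>inv x\<close>
    gives the negative of \<open>sb_lambda B (inv x) x\<close>.\<close>
  have "inv x \<in> J" if x: "x \<in> J" for x
  proof -
    have "inv x \<oplus> (inv x \<star> x \<oplus> x) = \<zero>"
      using mult_eq[of "inv x" x] x by (simp add: zero_eq_one)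
    then have "(inv x \<oplus> (inv x \<star> x \<oplus> x)) \<oplus> \<ominus> (inv x \<star> x \<oplus> x) = \<ominus> (inv x \<star> x \<oplus> x)"
      using x by (simp del: a_inv_add)
    then have "inv x = \<ominus> (inv x \<star> x \<oplus> x)"
      using x by simp
    moreover have "\<ominus> (inv x \<star> x \<oplus> x) \<in> J"
      using x by (intro neg add left) auto
    ultimately show ?thesis
      by metis
  qed
  moreover have "x \<otimes> y \<in> J" if "x \<in> J" "y \<in> J" for x y
    using that by (simp add: mult_eq add left)
  ultimately have 2: "subgroup J B"
    using sub zero by (intro subgroupI) auto
  have "c \<otimes> x \<otimes> inv c \<in> J" if c: "c \<in> carrier B" and x: "x \<in> J" for c x
  proof -
    \<comment> \<open>\<open>?y\<close> is an additive conjugate of \<open>sb_lambda B c x\<close>,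
      chosen so that \<open>c \<otimes> x = ?y \<oplus> c\<close> and \<open>add_mult_inv\<close>
      applies.\<close>
    let ?y = "c \<oplus> ((c \<star> x \<oplus> x) \<oplus> \<ominus> c)"
    have y: "?y \<in> J"
      using c x by (intro conj add left) auto
    have "c \<otimes> x = ?y \<oplus> c"
      using c x by (simp add: mult_eq)
    then have "c \<otimes> x \<otimes> inv c = ?y \<oplus> ?y \<star> inv c"
      using c y by (metis add_mult_inv mem)
    also have "\<dots> \<in> J"
      using c by (intro add[OF y] right y) auto
    finally show ?thesis .
  qed
  then have "J \<lhd> B"
    using 2 by (simp add: normal_inv_iff)
  moreover have "\<forall>b \<in> carrier B. sb_lambda B b ` J \<subseteq> J"
    by (auto simp add: lambda_eq add left)
  ultimately show ?thesis
    using 1 by (simp add: sb_ideal_def)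
qed

context
  fixes J assumes J: "sb_ideal J B"
begin

lemma ideal_normal_add: "J \<lhd> add_monoid B"
  using J by (simp add: sb_ideal_def)

lemma ideal_normal_mult: "J \<lhd> B"
  using J by (simp add: sb_ideal_def)

lemma ideal_subgroup_add: "subgroup J (add_monoid B)"
  using ideal_normal_add by (rule normal_imp_subgroup)

lemma ideal_mem: "x \<in> J \<Longrightarrow> x \<in> carrier B"
  using subgroup.subset[OF ideal_subgroup_add] by auto

lemma ideal_zero: "\<zero> \<in> J"
  using subgroup.one_closed[OF ideal_subgroup_add] by simp

lemma ideal_add: "\<lbrakk>x \<in> J; y \<in> J\<rbrakk> \<Longrightarrow> x \<oplus> y \<in> J"
  using subgroup.m_closed[OF ideal_subgroup_add] by simp

lemma ideal_neg: "x \<in> J \<Longrightarrow> \<ominus> x \<in> J"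
  using subgroup.m_inv_closed[OF ideal_subgroup_add] by (simp add: a_inv_def)

lemma ideal_conj: "\<lbrakk>c \<in> carrier B; x \<in> J\<rbrakk> \<Longrightarrow> c \<oplus> (x \<oplus> \<ominus> c) \<in> J"
  using normal.inv_op_closed2[OF ideal_normal_add, of c x] ideal_mem
  by (simp flip: a_inv_def)

lemma ideal_lambda: "\<lbrakk>c \<in> carrier B; x \<in> J\<rbrakk> \<Longrightarrow> sb_lambda B c x \<in> J"
  using J by (auto simp: sb_ideal_def)

lemma ideal_star_left: "\<lbrakk>c \<in> carrier B; x \<in> J\<rbrakk> \<Longrightarrow> c \<star> x \<in> J"
  using ideal_add[OF ideal_lambda[of c x] ideal_neg[of x]] ideal_mem by (simp add: lambda_eq)

text \<open>Multiplicative normality turns \<open>x \<otimes> c\<close> into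
  \<open>c \<otimes> ?x'\<close> with \<open>?x'\<close> in \<open>J\<close>, where invariance under
  \<open>sb_lambda\<close> can be used.\<close>

lemma ideal_star_right:
  assumes c: "c \<in> carrier B" and x: "x \<in> J"
  shows "x \<star> c \<in> J"
proof -
  let ?x' = "inv c \<otimes> x \<otimes> c"
  have x': "?x' \<in> J"
    using normal.inv_op_closed1[OF ideal_normal_mult c x] .
  have "x \<otimes> c = c \<otimes> ?x'"
    using c ideal_mem[OF x] by (simp add: m_assoc[symmetric])
  also have "\<dots> = c \<oplus> sb_lambda B c ?x'"
    using c ideal_mem[OF x'] by (simp add: mult_eq lambda_eq)
  finally have "x \<star> c = \<ominus> x \<oplus> (c \<oplus> (sb_lambda B c ?x' \<oplus> \<ominus> c))"
    using c ideal_mem[OF x] ideal_mem[OF x'] by (simp add: star_def)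
  also have "\<dots> \<in> J"
    using c x x' by (intro ideal_add ideal_neg ideal_conj ideal_lambda)
  finally show ?thesis .
qed

text \<open>This is why additive and multiplicative cosets of an ideal coincide: the quotient and
  the difference deviate from each other only by a star product with a factor in
  \<open>J\<close>.\<close>

lemma ideal_minus_iff_divide:
  assumes [simp]: "x \<in> carrier B" "y \<in> carrier B"
  shows "x \<otimes> inv y \<in> J \<longleftrightarrow> x \<oplus> \<ominus> y \<in> J"
proof
  assume j: "x \<oplus> \<ominus> y \<in> J"
  have "(x \<oplus> \<ominus> y) \<oplus> (x \<oplus> \<ominus> y) \<star> inv y \<in> J"
    by (intro ideal_add[OF j] ideal_star_right j) auto
  then show "x \<otimes> inv y \<in> J"
    using add_mult_inv[of "x \<oplus> \<ominus> y" y] by simp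
next
  assume j: "x \<otimes> inv y \<in> J"
  have "x = x \<otimes> inv y \<otimes> y"
    by (simp add: m_assoc)
  also have "\<dots> = x \<otimes> inv y \<oplus> ((x \<otimes> inv y) \<star> y \<oplus> y)"
    by (rule mult_eq) auto
  finally have "x \<oplus> \<ominus> y = x \<otimes> inv y \<oplus> ((x \<otimes> inv y) \<star> y \<oplus> y) \<oplus> \<ominus> y"
    by (rule arg_cong)
  then have "x \<oplus> \<ominus> y = x \<otimes> inv y \<oplus> (x \<otimes> inv y) \<star> y"
    by simp
  also have "\<dots> \<in> J"
    using j by (intro ideal_add ideal_star_right) auto
  finally show "x \<oplus> \<ominus> y \<in> J" .
qed

text \<open>Multiplicative commutators need no separate check. Modulo an ideal with all star
  products the product is the sum, so \<open>a \<otimes> b\<close> and \<open>b \<otimes> a\<close>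
  differ by an additive commutator, up to conjugates of star products.\<close>

lemma perfect_ideal_eq_carrier:
  assumes "sb_perfect B"
    and star: "\<And>a b. \<lbrakk>a \<in> carrier B; b \<in> carrier B\<rbrakk> \<Longrightarrow> a \<star> b \<in> J"
    and comm: "\<And>a b. \<lbrakk>a \<in> carrier B; b \<in> carrier B\<rbrakk> \<Longrightarrow> a \<oplus> (b \<oplus> (\<ominus> a \<oplus> \<ominus> b)) \<in> J"
  shows "J = carrier B"
proof -
  have "derived_set (add_monoid B) (carrier B) \<subseteq> J"
    using comm by (auto simp flip: a_inv_def)
  moreover have "a \<otimes> b \<otimes> inv a \<otimes> inv b \<in> J" if [simp]: "a \<in> carrier B" "b \<in> carrier B" for a b
  proof -
    have "a \<otimes> b \<oplus> \<ominus> (b \<otimes> a) = a \<oplus> (a \<star> b \<oplus> \<ominus> a) \<oplus> (a \<oplus> (b \<oplus> (\<ominus> a \<oplus> \<ominus> b))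
        \<oplus> (b \<oplus> (\<ominus> (b \<star> a) \<oplus> \<ominus> b)))"
      by (simp add: mult_eq)
    also have "\<dots> \<in> J"
      by (intro ideal_add ideal_conj ideal_neg star comm that)
    finally have "a \<otimes> b \<otimes> inv (b \<otimes> a) \<in> J"
      by (subst ideal_minus_iff_divide) auto
    then show ?thesis
      by (simp add: inv_mult_group m_assoc)
  qed
  then have "derived_set B (carrier B) \<subseteq> J"
    by auto
  moreover have "a \<otimes> b \<ominus> (a \<oplus> b) \<in> J" if "a \<in> carrier B" "b \<in> carrier B" for a b
    using ideal_conj[OF that(1) star[OF that]] that by (simp add: mult_eq)
  ultimately have "sb_commutator_ideal B \<subseteq> J"
    using J unfolding sb_commutator_ideal_def sb_genideal_def by blast
  then show ?thesis
    using assms(1) ideal_mem unfolding sb_perfect_def by blast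
qed

text \<open>Once star products vanish, \<open>b \<diamondop> (\<ominus> a)\<close> becomes the
  additive commutator of \<open>a\<close> and \<open>b\<close>.\<close>

lemma perfect_ideal_eq_carrier_ostar:
  assumes "sb_perfect B"
    and star: "\<And>a b. \<lbrakk>a \<in> carrier B; b \<in> carrier B\<rbrakk> \<Longrightarrow> a \<star> b \<in> J"
    and ostar: "\<And>a b. \<lbrakk>a \<in> carrier B; b \<in> carrier B\<rbrakk> \<Longrightarrow> a \<diamondop> b \<in> J"
  shows "J = carrier B"
proof (rule perfect_ideal_eq_carrier[OF assms(1) star])
  fix a b assume [simp]: "a \<in> carrier B" "b \<in> carrier B"
  let ?c = "\<ominus> (\<ominus> a) \<oplus> b"
  have "a \<oplus> (b \<oplus> (\<ominus> a \<oplus> \<ominus> b)) = ?c \<oplus> (\<ominus> (b \<star> (\<ominus> a)) \<oplus> \<ominus> ?c) \<oplus> b \<diamondop> (\<ominus> a)"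
    by (simp add: ostar_eq)
  also have "\<dots> \<in> J"
    by (intro ideal_add ideal_conj ideal_neg star ostar) auto
  finally show "a \<oplus> (b \<oplus> (\<ominus> a \<oplus> \<ominus> b)) \<in> J" .
qed

end

section \<open>Additive centralizers\<close>

definition centralizer where "centralizer S = {x \<in> carrier B. \<forall>s \<in> S. x \<oplus> s = s \<oplus> x}"

lemma centralizerD: "\<lbrakk>x \<in> centralizer S; s \<in> S\<rbrakk> \<Longrightarrow> x \<oplus> s = s \<oplus> x"
  by (simp add: centralizer_def)

lemma centralizer_add:
  assumes "S \<subseteq> carrier B" "x \<in> centralizer S" "y \<in> centralizer S"
  shows "x \<oplus> y \<in> centralizer S"
proof -
  have "(x \<oplus> y) \<oplus> s = s \<oplus> (x \<oplus> y)" if "s \<in> S" for s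
  proof -
    have [simp]: "x \<in> carrier B" "y \<in> carrier B" "s \<in> carrier B"
      using that assms by (auto simp: centralizer_def)
    have "x \<oplus> s = s \<oplus> x" "y \<oplus> s = s \<oplus> y"
      using that assms by (auto simp: centralizer_def)
    then show ?thesis
      by (metis a_assoc \<open>x \<in> carrier B\<close> \<open>y \<in> carrier B\<close> \<open>s \<in> carrier B\<close>)
  qed
  then show ?thesis
    using assms by (simp add: centralizer_def)
qed

lemma centralizer_neg:
  assumes "S \<subseteq> carrier B" "x \<in> centralizer S"
  shows "\<ominus> x \<in> centralizer S"
proof -
  have "\<ominus> x \<oplus> s = s \<oplus> \<ominus> x" if "s \<in> S" for s
  proof -
    have [simp]: "x \<in> carrier B" "s \<in> carrier B"
      using that assms by (auto simp: centralizer_def)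
    have "\<ominus> x \<oplus> (s \<oplus> x) \<oplus> \<ominus> x = \<ominus> x \<oplus> (x \<oplus> s) \<oplus> \<ominus> x"
      using that assms by (simp add: centralizer_def)
    then show ?thesis by simp
  qed
  then show ?thesis
    using assms by (simp add: centralizer_def)
qed

text \<open>Conjugation, \<open>sb_lambda B c\<close> and \<open>rho c\<close> are additive
  automorphisms. To see that the image of \<open>x\<close> commutes with \<open>s\<close>, pull
  \<open>s\<close> back by the inverse automorphism and apply the hypothesis there. The set
  \<open>S\<close> itself may fail to be invariant: images of \<open>s\<close> only have to lie in
  \<open>centralizer {x}\<close>, a subgroup, so it suffices to write them as sums of suitable
  elements.\<close>

lemma centralizer_ideal:
  assumes S: "S \<subseteq> carrier B"
    and conj: "\<And>x s c. \<lbrakk>x \<in> centralizer S; s \<in> S; c \<in> carrier B\<rbrakk>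
      \<Longrightarrow> c \<oplus> (s \<oplus> \<ominus> c) \<in> centralizer {x}"
    and lambda: "\<And>x s c. \<lbrakk>x \<in> centralizer S; s \<in> S; c \<in> carrier B\<rbrakk>
      \<Longrightarrow> sb_lambda B c s \<in> centralizer {x}"
    and rho: "\<And>x s c. \<lbrakk>x \<in> centralizer S; s \<in> S; c \<in> carrier B\<rbrakk> \<Longrightarrow> rho c s \<in> centralizer {x}"
  shows "sb_ideal (centralizer S) B"
proof (rule sb_idealI)
  show "centralizer S \<subseteq> carrier B" "\<zero> \<in> centralizer S"
    using S by (auto simp: centralizer_def subset_iff)
  fix x c assume x: "x \<in> centralizer S" and c [simp]: "c \<in> carrier B"
  then have [simp]: "x \<in> carrier B"
    by (simp add: centralizer_def)
  note SD [simp] = subsetD[OF S]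
  have "c \<oplus> (x \<oplus> \<ominus> c) \<oplus> s = s \<oplus> (c \<oplus> (x \<oplus> \<ominus> c))" if s: "s \<in> S" for s
  proof -
    let ?t = "\<ominus> c \<oplus> (s \<oplus> c)"
    have "?t \<oplus> x = x \<oplus> ?t"
      using conj[OF x s, of "\<ominus> c"] by (simp add: centralizer_def)
    then have "c \<oplus> ((x \<oplus> ?t) \<oplus> \<ominus> c) = c \<oplus> ((?t \<oplus> x) \<oplus> \<ominus> c)"
      by simp
    then show ?thesis
      using s by simp
  qed
  then show "c \<oplus> (x \<oplus> \<ominus> c) \<in> centralizer S"
    by (simp add: centralizer_def)
  have "sb_lambda B c x \<oplus> s = s \<oplus> sb_lambda B c x" if s: "s \<in> S" for s
  proof -
    let ?t = "sb_lambda B (inv c) s"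
    have "x \<oplus> ?t = ?t \<oplus> x"
      using lambda[OF x s, of "inv c"] by (simp add: centralizer_def)
    then have "sb_lambda B c (x \<oplus> ?t) = sb_lambda B c (?t \<oplus> x)"
      by simp
    then show ?thesis
      using s by (simp add: lambda_add lambda_lambda_inv)
  qed
  then have "sb_lambda B c x \<in> centralizer S"
    by (simp add: centralizer_def)
  from centralizer_add[OF S this centralizer_neg[OF S x]] show "c \<star> x \<in> centralizer S"
    by (simp add: lambda_eq)
  have "rho c x \<oplus> s = s \<oplus> rho c x" if s: "s \<in> S" for s
  proof -
    let ?t = "rho (inv c) s"
    have "x \<oplus> ?t = ?t \<oplus> x"
      using rho[OF x s, of "inv c"] by (simp add: centralizer_def)
    then have "rho c (x \<oplus> ?t) = rho c (?t \<oplus> x)"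
      by simp
    then show ?thesis
      using s by (simp add: rho_add rho_rho_inv)
  qed
  then have "rho c x \<in> centralizer S"
    by (simp add: centralizer_def)
  from centralizer_add[OF S centralizer_neg[OF S x] this] show "x \<star> c \<in> centralizer S"
    by (simp add: rho_eq)
qed (use S in \<open>auto intro: centralizer_add centralizer_neg\<close>)

subsection \<open>The ideals centralizing the star products\<close>

lemma mem_centralizer_singleton:
  "\<lbrakk>x \<in> centralizer S; s \<in> S; s \<in> carrier B\<rbrakk> \<Longrightarrow> s \<in> centralizer {x}"
  by (auto simp: centralizer_def)

lemma centralizer_of_ideal:
  assumes J: "sb_ideal J B"
  shows "sb_ideal (centralizer J) B"
proof (rule centralizer_ideal)
  show "J \<subseteq> carrier B"
    using ideal_mem[OF J] by auto
  fix x s c assume x: "x \<in> centralizer J" and s: "s \<in> J" and c: "c \<in> carrier B"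
  have *: "t \<in> centralizer {x}" if "t \<in> J" for t
    using x that ideal_mem[OF J that] by (rule mem_centralizer_singleton)
  show "c \<oplus> (s \<oplus> \<ominus> c) \<in> centralizer {x}" "sb_lambda B c s \<in> centralizer {x}"
    using J s c by (auto intro!: * ideal_conj ideal_lambda)
  have "s \<oplus> s \<star> c \<in> J"
    using J s c by (intro ideal_add ideal_star_right)
  then show "rho c s \<in> centralizer {x}"
    using ideal_mem[OF J s] c by (simp add: * rho_eq)
qed

lemma carrier_ideal: "sb_ideal (carrier B) B"
  by (rule sb_idealI) auto

lemma ideal_Int:
  assumes "sb_ideal I B" "sb_ideal J B"
  shows "sb_ideal (I \<inter> J) B"
  using assms
  by (intro sb_idealI)
    (auto dest: ideal_mem intro: ideal_zero ideal_add ideal_neg ideal_conj ideal_star_left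
      ideal_star_right)

text \<open>By the distributive laws for \<open>\<star>\<close>, a star product with
  \<open>i \<oplus> j\<close> splits, up to conjugation, into a term of \<open>I\<close> and a term
  of \<open>J\<close>.\<close>

lemma ideal_set_add:
  assumes I: "sb_ideal I B" and J: "sb_ideal J B"
  shows "sb_ideal (set_add B I J) B"
proof (rule sb_idealI)
  note mem [simp] = ideal_mem[OF I] ideal_mem[OF J]
  have iff: "x \<in> set_add B I J \<longleftrightarrow> (\<exists>i\<in>I. \<exists>j\<in>J. x = i \<oplus> j)" for x
    by (auto simp: set_add_def set_mult_def)
  then show "set_add B I J \<subseteq> carrier B"
    by auto
  show "\<zero> \<in> set_add B I J"
    using ideal_zero[OF I] ideal_zero[OF J] by (force simp: iff)
  fix x assume "x \<in> set_add B I J"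
  then obtain i j where ij [simp]: "i \<in> I" "j \<in> J" and x: "x = i \<oplus> j"
    by (auto simp: iff)
  have "j \<oplus> (\<ominus> i \<oplus> \<ominus> j) \<in> I" "\<ominus> j \<oplus> (\<ominus> i \<oplus> \<ominus> (\<ominus> j)) \<in> I" "\<ominus> j \<in> J"
    by (intro ideal_conj[OF I] ideal_neg[OF I] ideal_neg[OF J] a_inv_closed mem ij)+
  moreover have "\<ominus> x = (\<ominus> j \<oplus> (\<ominus> i \<oplus> \<ominus> (\<ominus> j))) \<oplus> \<ominus> j"
    by (simp add: x)
  ultimately show "\<ominus> x \<in> set_add B I J"
    by (metis iff)
  {
    fix y assume "y \<in> set_add B I J"
    then obtain i' j' where ij' [simp]: "i' \<in> I" "j' \<in> J" and y: "y = i' \<oplus> j'"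
      by (auto simp: iff)
    have "i \<oplus> (j \<oplus> (i' \<oplus> \<ominus> j)) \<in> I" "j \<oplus> j' \<in> J"
      by (auto intro!: ideal_add[OF I] ideal_conj[OF I] ideal_add[OF J])
    moreover have "x \<oplus> y = (i \<oplus> (j \<oplus> (i' \<oplus> \<ominus> j))) \<oplus> (j \<oplus> j')"
      by (simp add: x y)
    ultimately show "x \<oplus> y \<in> set_add B I J"
      by (metis iff)
  }
  fix c assume c [simp]: "c \<in> carrier B"
  have "c \<oplus> (x \<oplus> \<ominus> c) = (c \<oplus> (i \<oplus> \<ominus> c)) \<oplus> (c \<oplus> (j \<oplus> \<ominus> c))"
    by (simp add: x)
  then show "c \<oplus> (x \<oplus> \<ominus> c) \<in> set_add B I J"
    using ideal_conj[OF I c ij(1)] ideal_conj[OF J c ij(2)] by (metis iff)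
  have "c \<star> x = c \<star> i \<oplus> (i \<oplus> (c \<star> j \<oplus> \<ominus> i))"
    by (simp add: x star_add_right)
  moreover have "c \<star> i \<in> I" "i \<oplus> (c \<star> j \<oplus> \<ominus> i) \<in> J"
    by (auto intro!: ideal_star_left[OF I] ideal_star_left[OF J] ideal_conj[OF J])
  ultimately show "c \<star> x \<in> set_add B I J"
    by (metis iff)
  have "x \<star> c = (\<ominus> j \<oplus> (i \<star> c \<oplus> \<ominus> (\<ominus> j))) \<oplus> j \<star> c"
    by (simp add: x star_add_left)
  moreover have "\<ominus> j \<oplus> (i \<star> c \<oplus> \<ominus> (\<ominus> j)) \<in> I" "j \<star> c \<in> J"
    by (intro ideal_conj[OF I] ideal_star_right[OF I] ideal_star_right[OF J] a_inv_closed mem ij c)+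
  ultimately show "x \<star> c \<in> set_add B I J"
    by (metis iff)
qed

definition stars where "stars = {a \<star> b |a b. a \<in> carrier B \<and> b \<in> carrier B}"

definition ostars where "ostars = {a \<diamondop> b |a b. a \<in> carrier B \<and> b \<in> carrier B}"

lemma stars_subset: "stars \<subseteq> carrier B" and ostars_subset: "ostars \<subseteq> carrier B"
  by (auto simp: stars_def ostars_def)

lemma centralizer_stars_ideal: "sb_ideal (centralizer stars) B"
proof (rule centralizer_ideal[OF stars_subset])
  fix x s c assume x: "x \<in> centralizer stars" and "s \<in> stars" and c [simp]: "c \<in> carrier B"
  then obtain a b where [simp]: "a \<in> carrier B" "b \<in> carrier B" and s: "s = a \<star> b"
    by (auto simp: stars_def)
  have cx: "{x} \<subseteq> carrier B"
    using x by (auto simp: centralizer_def)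
  have *: "u \<star> v \<in> centralizer {x}" if "u \<in> carrier B" "v \<in> carrier B" for u v
    using x that by (intro mem_centralizer_singleton[of _ stars]) (auto simp: stars_def)
  \<comment> \<open>\<open>star_add_right\<close> read backwards: a conjugate of a star product is a
    combination of two star products.\<close>
  have "c \<oplus> (s \<oplus> \<ominus> c) = \<ominus> (a \<star> c) \<oplus> a \<star> (c \<oplus> b)"
    by (simp add: s star_add_right)
  also have "\<dots> \<in> centralizer {x}"
    by (intro centralizer_add[OF cx] centralizer_neg[OF cx] *) auto
  finally show "c \<oplus> (s \<oplus> \<ominus> c) \<in> centralizer {x}" .
  have "c \<star> s \<oplus> s \<in> centralizer {x}" "s \<oplus> s \<star> c \<in> centralizer {x}"
    by (auto intro!: centralizer_add[OF cx] * simp: s)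
  then show "sb_lambda B c s \<in> centralizer {x}" "rho c s \<in> centralizer {x}"
    by (simp_all add: lambda_eq rho_eq s)
qed

lemma centralizer_ostars_ideal: "sb_ideal (centralizer ostars) B"
proof (rule centralizer_ideal[OF ostars_subset])
  fix x s c assume x: "x \<in> centralizer ostars" and "s \<in> ostars" and c [simp]: "c \<in> carrier B"
  then obtain a b where [simp]: "a \<in> carrier B" "b \<in> carrier B" and s: "s = a \<diamondop> b"
    by (auto simp: ostars_def)
  have cx: "{x} \<subseteq> carrier B"
    using x by (auto simp: centralizer_def)
  have *: "u \<diamondop> v \<in> centralizer {x}" if "u \<in> carrier B" "v \<in> carrier B" for u v
    using x that by (intro mem_centralizer_singleton[of _ ostars]) (auto simp: ostars_def)
  \<comment> \<open>The same device for \<open>\<diamondop>\<close>, through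
    \<open>ostar_add_right\<close>. Here \<open>sb_lambda B c s\<close> and \<open>rho c s\<close>
    are sums of conjugates of \<open>\<diamondop>\<close> products, so conjugation is settled first
    for arbitrary arguments.\<close>
  have conj: "d \<oplus> (u \<diamondop> v \<oplus> \<ominus> d) \<in> centralizer {x}"
    if [simp]: "u \<in> carrier B" "v \<in> carrier B" "d \<in> carrier B" for u v d
  proof -
    have "d \<oplus> (u \<diamondop> v \<oplus> \<ominus> d) = u \<diamondop> (v \<oplus> \<ominus> d) \<oplus> \<ominus> (u \<diamondop> (\<ominus> d))"
      by (simp add: ostar_add_right)
    also have "\<dots> \<in> centralizer {x}"
      by (intro centralizer_add[OF cx] centralizer_neg[OF cx] *) auto
    finally show ?thesis .
  qed
  show "c \<oplus> (s \<oplus> \<ominus> c) \<in> centralizer {x}"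
    by (simp add: s conj)
  have "sb_lambda B c s = (\<ominus> c \<oplus> (a \<diamondop> b \<oplus> \<ominus> (\<ominus> c))) \<oplus> (\<ominus> c \<oplus> (c \<diamondop> s \<oplus> \<ominus> (\<ominus> c)))"
    by (simp add: s lambda_eq ostar_eq)
  also have "\<dots> \<in> centralizer {x}"
    by (intro centralizer_add[OF cx] conj) (auto simp: s)
  finally show "sb_lambda B c s \<in> centralizer {x}" .
  have "rho c s = (c \<oplus> (s \<diamondop> c \<oplus> \<ominus> c)) \<oplus> (c \<oplus> (a \<diamondop> b \<oplus> \<ominus> c))"
    by (simp add: s rho_eq ostar_eq)
  also have "\<dots> \<in> centralizer {x}"
    by (intro centralizer_add[OF cx] conj) (auto simp: s)
  finally show "rho c s \<in> centralizer {x}" .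
qed

lemma star_in_centralizer_ostars:
  "\<lbrakk>a \<in> carrier B; b \<in> carrier B\<rbrakk> \<Longrightarrow> a \<star> b \<in> centralizer ostars"
  by (auto simp: centralizer_def ostars_def star_ostar_commute)

lemma ostar_in_centralizer_stars:
  "\<lbrakk>a \<in> carrier B; b \<in> carrier B\<rbrakk> \<Longrightarrow> a \<diamondop> b \<in> centralizer stars"
  by (auto simp: centralizer_def stars_def star_ostar_commute)

text \<open>Every element of the intersection commutes with all \<open>a \<star> b\<close> and all
  \<open>a \<diamondop> b\<close>. The centralizer of the intersection is therefore an ideal
  containing both kinds of products, hence everything.\<close>

lemma perfect_centralizers_Int:
  assumes "sb_perfect B"
  shows "centralizer ostars \<inter> centralizer stars = centralizer (carrier B)"
proof
  define I where "I = centralizer ostars \<inter> centralizer stars"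
  have I: "sb_ideal I B"
    unfolding I_def by (intro ideal_Int centralizer_stars_ideal centralizer_ostars_ideal)
  have "centralizer I = carrier B"
  proof (rule perfect_ideal_eq_carrier_ostar[OF centralizer_of_ideal[OF I] assms])
    fix a b assume ab: "a \<in> carrier B" "b \<in> carrier B"
    have "x \<oplus> a \<star> b = a \<star> b \<oplus> x" "x \<oplus> a \<diamondop> b = a \<diamondop> b \<oplus> x" if "x \<in> I" for x
      using that ab by (auto simp: I_def centralizer_def stars_def ostars_def)
    then show "a \<star> b \<in> centralizer I" "a \<diamondop> b \<in> centralizer I"
      using ab by (simp_all add: centralizer_def)
  qed
  then have "y \<in> centralizer I" if "y \<in> carrier B" for y
    using that by simp
  then have "x \<oplus> y = y \<oplus> x" if "x \<in> I" "y \<in> carrier B" for x y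
    using that by (intro centralizerD[symmetric])
  then show "centralizer ostars \<inter> centralizer stars \<subseteq> centralizer (carrier B)"
    using ideal_mem[OF I] by (auto simp: I_def[symmetric] centralizer_def[of "carrier B"])
  show "centralizer (carrier B) \<subseteq> centralizer ostars \<inter> centralizer stars"
    using stars_subset ostars_subset by (auto simp: centralizer_def)
qed

lemma perfect_centralizers_sum:
  assumes "sb_perfect B"
  shows "set_add B (centralizer ostars) (centralizer stars) = carrier B"
proof (rule perfect_ideal_eq_carrier_ostar[OF _ assms])
  show "sb_ideal (set_add B (centralizer ostars) (centralizer stars)) B"
    by (intro ideal_set_add centralizer_stars_ideal centralizer_ostars_ideal)
  fix a b assume ab: "a \<in> carrier B" "b \<in> carrier B"
  have "a \<star> b \<oplus> \<zero> \<in> set_add B (centralizer ostars) (centralizer stars)"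
    using star_in_centralizer_ostars[OF ab] ideal_zero[OF centralizer_stars_ideal]
    unfolding set_add_def set_mult_def by force
  then show "a \<star> b \<in> set_add B (centralizer ostars) (centralizer stars)"
    using ab by simp
  have "\<zero> \<oplus> a \<diamondop> b \<in> set_add B (centralizer ostars) (centralizer stars)"
    using ostar_in_centralizer_stars[OF ab] ideal_zero[OF centralizer_ostars_ideal]
    unfolding set_add_def set_mult_def by force
  then show "a \<diamondop> b \<in> set_add B (centralizer ostars) (centralizer stars)"
    using ab by simp
qed

subsection \<open>The center of a finite perfect two-sided skew brace\<close>

text \<open>
  Nakayama's lemma for the left ideals above \<open>K\<close>: if \<open>N\<close> is a maximal proper one and
  \<open>B \<star> m\<close> is not contained in \<open>N\<close>, then \<open>N + B \<star> m\<close> is everything, so \<open>- m \<equiv> b \<star> m\<close>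
  modulo \<open>N\<close> for some \<open>b\<close>. This says \<open>\<lambda>\<^sub>b(m) \<in> N\<close>, hence \<open>m \<in> N\<close>.
\<close>

lemma perfect_ideal_abelian_quotient:
  assumes fin: "finite (carrier B)" and perf: "sb_perfect B" and K: "sb_ideal K B"
    and comm: "\<And>a b. \<lbrakk>a \<in> carrier B; b \<in> carrier B\<rbrakk> \<Longrightarrow> a \<oplus> (b \<oplus> (\<ominus> a \<oplus> \<ominus> b)) \<in> K"
  shows "K = carrier B"
proof (rule ccontr)
  assume neq: "K \<noteq> carrier B"
  \<comment> \<open>Normality and zero can be left out of the definition: zero comes from
    \<open>K\<close>, and any subgroup above \<open>K\<close> is normal because \<open>K\<close>
    contains the additive commutators.\<close>
  define left_ideal where "left_ideal N \<longleftrightarrow> K \<subseteq> N \<and> N \<subseteq> carrier B \<and>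
    (\<forall>x\<in>N. \<forall>y\<in>N. x \<oplus> y \<in> N) \<and> (\<forall>x\<in>N. \<ominus> x \<in> N) \<and> (\<forall>c\<in>carrier B. \<forall>x\<in>N. c \<star> x \<in> N)" for N
  have "left_ideal K"
    using K by (auto simp: left_ideal_def ideal_mem ideal_add ideal_neg ideal_star_left)
  moreover have "finite {N. left_ideal N \<and> N \<noteq> carrier B}"
    by (rule finite_subset[of _ "Pow (carrier B)"]) (auto simp: left_ideal_def fin)
  ultimately obtain N where N: "left_ideal N" and proper: "N \<noteq> carrier B"
    and maxi: "\<And>M. \<lbrakk>left_ideal M; M \<noteq> carrier B; N \<subseteq> M\<rbrakk> \<Longrightarrow> N = M"
    using finite_has_maximal[of "{N. left_ideal N \<and> N \<noteq> carrier B}"] neq by blast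
  have KN: "K \<subseteq> N" and sub: "N \<subseteq> carrier B"
    and Nadd: "\<And>x y. \<lbrakk>x \<in> N; y \<in> N\<rbrakk> \<Longrightarrow> x \<oplus> y \<in> N"
    and Nneg: "\<And>x. x \<in> N \<Longrightarrow> \<ominus> x \<in> N"
    and Nstar: "\<And>c x. \<lbrakk>c \<in> carrier B; x \<in> N\<rbrakk> \<Longrightarrow> c \<star> x \<in> N"
    using N unfolding left_ideal_def by blast+
  have mem [simp]: "x \<in> carrier B" if "x \<in> N" for x
    using that sub by blast
  have Nconj: "c \<oplus> (x \<oplus> \<ominus> c) \<in> N" if [simp]: "c \<in> carrier B" and x: "x \<in> N" for c x
  proof -
    have "c \<oplus> (x \<oplus> (\<ominus> c \<oplus> \<ominus> x)) \<in> N"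
      using comm[of c x] x KN by auto
    from Nadd[OF this x] have "c \<oplus> (x \<oplus> (\<ominus> c \<oplus> \<ominus> x)) \<oplus> x \<in> N" .
    then show ?thesis
      using x by simp
  qed
  have Nzero: "\<zero> \<in> N"
    using KN ideal_zero[OF K] by auto
  \<comment> \<open>Otherwise \<open>N\<close> would absorb stars on both sides, and so be a proper
    ideal containing all star products and additive commutators, against perfectness.\<close>
  have ex: "\<exists>m\<in>carrier B. \<exists>b\<in>carrier B. b \<star> m \<notin> N"
  proof (rule ccontr)
    assume "\<not> ?thesis"
    then have star: "b \<star> m \<in> N" if "m \<in> carrier B" "b \<in> carrier B" for b m
      using that by blast
    have "sb_ideal N B"
      by (rule sb_idealI) (use sub Nzero Nadd Nneg Nconj star in auto)
    then have "N = carrier B"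
      by (rule perfect_ideal_eq_carrier[OF _ perf]) (use star comm KN in auto)
    then show False
      using proper by simp
  qed
  have "subgroup N (add_monoid B)"
    using sub Nzero Nadd Nneg by (intro add.subgroupI) (auto simp flip: a_inv_def)
  moreover have "x \<oplus> h \<oplus> \<ominus> x \<in> N" if "x \<in> carrier B" "h \<in> N" for x h
    using Nconj[OF that] that by simp
  ultimately have normal: "N \<lhd> add_monoid B"
    by (simp add: add.normal_inv_iff flip: a_inv_def)
  \<comment> \<open>Congruence modulo \<open>N\<close> is treated in the additive quotient group,
    which is abelian. No quotient skew brace is formed, since \<open>N\<close> is only a left
    ideal.\<close>
  define Q where "Q = add_monoid B Mod N"
  define q where "q x = N #>\<^bsub>add_monoid B\<^esub> x" for x
  interpret Q: group Q
    unfolding Q_def by (rule normal.factorgroup_is_group[OF normal])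
  have hom: "q \<in> hom (add_monoid B) Q"
    unfolding Q_def q_def by (rule normal.r_coset_hom_Mod[OF normal])
  interpret q: group_hom "add_monoid B" Q q
    by unfold_locales (rule hom)
  have qcl [simp]: "q x \<in> carrier Q" if "x \<in> carrier B" for x
    using that q.hom_closed by simp
  have qadd: "q (x \<oplus> y) = q x \<otimes>\<^bsub>Q\<^esub> q y" if "x \<in> carrier B" "y \<in> carrier B" for x y
    using that q.hom_mult by simp
  have qneg: "q (\<ominus> x) = inv\<^bsub>Q\<^esub> q x" if "x \<in> carrier B" for x
    using that q.hom_inv by (simp add: a_inv_def)
  have qone: "q x = \<one>\<^bsub>Q\<^esub> \<longleftrightarrow> x \<in> N" if "x \<in> carrier B" for x
    using that add.coset_join1[of N x] add.coset_join2[of x N] normal_imp_subgroup[OF normal] sub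
    by (auto simp: Q_def q_def FactGroup_def)
  have qeq: "q x = q y \<longleftrightarrow> x \<oplus> \<ominus> y \<in> N" if [simp]: "x \<in> carrier B" "y \<in> carrier B" for x y
    using qone[of "x \<oplus> \<ominus> y"]
    by (simp add: qadd qneg) (metis Q.inv_solve_right Q.l_one Q.one_closed qcl that)
  have qcomm: "q x \<otimes>\<^bsub>Q\<^esub> q y = q y \<otimes>\<^bsub>Q\<^esub> q x" if [simp]: "x \<in> carrier B" "y \<in> carrier B" for x y
  proof -
    have "q (x \<oplus> y) = q (y \<oplus> x)"
      using comm[of x y] KN by (auto simp: qeq)
    then show ?thesis
      by (simp add: qadd)
  qed
  \<comment> \<open>The conjugation by \<open>b\<close> in \<open>star_add_left\<close> disappears
    in the abelian group \<open>Q\<close>.\<close>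
  have qstar_add: "q ((a \<oplus> b) \<star> m) = q (a \<star> m) \<otimes>\<^bsub>Q\<^esub> q (b \<star> m)"
    if [simp]: "a \<in> carrier B" "b \<in> carrier B" "m \<in> carrier B" for a b m
  proof -
    have "q ((a \<oplus> b) \<star> m) = q (\<ominus> b \<oplus> a \<star> m) \<otimes>\<^bsub>Q\<^esub> q (b \<oplus> b \<star> m)"
      by (simp add: star_add_left flip: qadd)
    also have "\<dots> = q (a \<star> m \<oplus> \<ominus> b) \<otimes>\<^bsub>Q\<^esub> q (b \<oplus> b \<star> m)"
      by (simp add: qadd qcomm)
    also have "\<dots> = q (a \<star> m) \<otimes>\<^bsub>Q\<^esub> q (b \<star> m)"
      by (simp flip: qadd)
    finally show ?thesis .
  qed
  \<comment> \<open>Expand \<open>(a \<otimes> b) \<star> m\<close> by \<open>star_mult_left\<close>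
    and, alternatively, through \<open>a \<otimes> b = a \<oplus> (a \<star> b \<oplus> b)\<close>;
    then cancel.\<close>
  have qassoc: "q (a \<star> (b \<star> m)) = q ((a \<star> b) \<star> m)"
    if [simp]: "a \<in> carrier B" "b \<in> carrier B" "m \<in> carrier B" for a b m
  proof -
    have "q (a \<star> (b \<star> m)) \<otimes>\<^bsub>Q\<^esub> (q (b \<star> m) \<otimes>\<^bsub>Q\<^esub> q (a \<star> m)) = q ((a \<otimes> b) \<star> m)"
      by (simp add: star_mult_left qadd)
    also have "\<dots> = q (a \<star> m) \<otimes>\<^bsub>Q\<^esub> (q ((a \<star> b) \<star> m) \<otimes>\<^bsub>Q\<^esub> q (b \<star> m))"
      by (simp add: mult_eq qstar_add)
    also have "\<dots> = q ((a \<star> b) \<star> m) \<otimes>\<^bsub>Q\<^esub> q (b \<star> m) \<otimes>\<^bsub>Q\<^esub> q (a \<star> m)"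
      using qcomm[of "a \<star> m" "(a \<star> b) \<star> m \<oplus> b \<star> m"] by (simp add: qadd)
    finally show ?thesis
      by (simp add: Q.m_assoc)
  qed
  have qstar_cong: "q (c \<star> x) = q (c \<star> y)"
    if "q x = q y" and [simp]: "c \<in> carrier B" "x \<in> carrier B" "y \<in> carrier B" for c x y
  proof -
    have "x \<oplus> \<ominus> y \<in> N" "x = (x \<oplus> \<ominus> y) \<oplus> y"
      using that by (simp_all add: qeq)
    then obtain n where n [simp]: "n \<in> N" and x: "x = n \<oplus> y"
      by blast
    have "c \<star> x = c \<star> n \<oplus> (n \<oplus> (c \<star> y \<oplus> \<ominus> n))"
      by (simp add: x star_add_right)
    then have "q (c \<star> x) = q (c \<star> n) \<otimes>\<^bsub>Q\<^esub> (q n \<otimes>\<^bsub>Q\<^esub> (q (c \<star> y) \<otimes>\<^bsub>Q\<^esub> q (\<ominus> n)))"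
      by (simp add: qadd)
    moreover have "q (c \<star> n) = \<one>\<^bsub>Q\<^esub>" "q n = \<one>\<^bsub>Q\<^esub>" "q (\<ominus> n) = \<one>\<^bsub>Q\<^esub>"
      using qone[of "c \<star> n"] qone[of n] qone[of "\<ominus> n"] n Nstar[of c n] Nneg[of n]
      by simp_all
    ultimately show ?thesis
      by simp
  qed
  have star_N: "b \<star> m \<in> N" if m [simp]: "m \<in> carrier B" and b: "b \<in> carrier B" for b m
  proof -
    \<comment> \<open>\<open>M\<close> is \<open>N\<close> plus the set of all
      \<open>b \<star> m\<close>, encoded as a preimage under \<open>q\<close>. It is a subgroup by
      \<open>qstar_add\<close>, and \<open>qassoc\<close> absorbs a further star on the
      left.\<close>
    define M where "M = {x \<in> carrier B. \<exists>b\<in>carrier B. q x = q (b \<star> m)}"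
    have M_iff: "x \<in> M \<longleftrightarrow> x \<in> carrier B \<and> (\<exists>b\<in>carrier B. q x = q (b \<star> m))" for x
      by (simp add: M_def)
    have qstar_neg: "q ((\<ominus> b) \<star> m) = inv\<^bsub>Q\<^esub> q (b \<star> m)" if "b \<in> carrier B" for b
      using qstar_add[of "\<ominus> b" b m] that qone[OF zero_closed] Nzero
      by (intro Q.inv_equality[symmetric]) simp_all
    have "left_ideal M"
      unfolding left_ideal_def
    proof (intro conjI ballI subsetI)
      fix x assume "x \<in> K"
      then have "x \<in> N"
        using KN by blast
      then show "x \<in> M"
        using qone[of x] qone[of \<zero>] Nzero by (auto simp: M_iff intro!: bexI[of _ \<zero>])
    next
      fix x y assume "x \<in> M" "y \<in> M"
      then obtain b c where "x \<in> carrier B" "y \<in> carrier B" "b \<in> carrier B" "c \<in> carrier B"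
        "q x = q (b \<star> m)" "q y = q (c \<star> m)"
        by (auto simp: M_iff)
      then show "x \<oplus> y \<in> M"
        by (auto simp: M_iff qadd qstar_add intro!: bexI[of _ "b \<oplus> c"])
    next
      fix x assume "x \<in> M"
      then obtain b where "x \<in> carrier B" "b \<in> carrier B" "q x = q (b \<star> m)"
        by (auto simp: M_iff)
      then show "\<ominus> x \<in> M"
        by (auto simp: M_iff qneg qstar_neg intro!: bexI[of _ "\<ominus> b"])
    next
      fix c x assume "x \<in> M" and c: "c \<in> carrier B"
      then obtain b where "x \<in> carrier B" "b \<in> carrier B" "q x = q (b \<star> m)"
        by (auto simp: M_iff)
      then have "c \<star> x \<in> carrier B" "q (c \<star> x) = q ((c \<star> b) \<star> m)" "c \<star> b \<in> carrier B"
        using c qstar_cong[of x "b \<star> m" c] qassoc[of c b m] by auto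
      then show "c \<star> x \<in> M"
        unfolding M_iff by blast
    qed (auto simp: M_iff)
    moreover have "N \<subseteq> M"
    proof
      fix x assume x: "x \<in> N"
      have "q x = q (\<zero> \<star> m)"
        using x Nzero qone[of x] qone[of \<zero>] by simp
      then show "x \<in> M"
        using x by (intro M_iff[THEN iffD2] conjI bexI[of _ \<zero>] mem zero_closed)
    qed
    \<comment> \<open>By maximality \<open>M\<close> is \<open>N\<close> or everything. In the first
      case \<open>b \<star> m\<close>, an element of \<open>M\<close>, is in \<open>N\<close>; the
      second case yields \<open>m \<in> N\<close>.\<close>
    ultimately have "M \<noteq> carrier B \<Longrightarrow> N = M"
      by (intro maxi)
    moreover have "b \<star> m \<in> M"
      using b by (auto simp: M_iff)
    moreover have ?thesis if "M = carrier B"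
    proof -
      have "\<ominus> m \<in> M"
        using that by simp
      then obtain c where c [simp]: "c \<in> carrier B" and "q (\<ominus> m) = q (c \<star> m)"
        by (auto simp: M_iff)
      then have "\<ominus> m \<oplus> \<ominus> (c \<star> m) \<in> N"
        by (simp add: qeq)
      from Nneg[OF this] have l: "sb_lambda B c m \<in> N"
        by (simp add: lambda_eq)
      have "sb_lambda B (inv c) (sb_lambda B c m) \<in> N"
        using Nadd[OF Nstar[OF _ l, of "inv c"] l] by (simp add: lambda_eq)
      then have "m \<in> N"
        using lambda_lambda_inv[of "inv c" m] by simp
      then show ?thesis
        by (rule Nstar[OF b])
    qed
    ultimately show ?thesis
      by metis
  qed
  with ex show False
    by blast
qed

section \<open>Star products with additively central elements\<close>

context
  fixes z assumes z: "z \<in> centralizer (carrier B)"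
begin

lemma central_mem: "z \<in> carrier B"
  using z by (simp add: centralizer_def)

lemma central_star: "a \<in> carrier B \<Longrightarrow> a \<star> z \<in> centralizer (carrier B)"
  and star_central: "a \<in> carrier B \<Longrightarrow> z \<star> a \<in> centralizer (carrier B)"
  using ideal_star_left ideal_star_right centralizer_of_ideal[OF carrier_ideal] z by blast+

lemma central_commute: "a \<in> carrier B \<Longrightarrow> a \<oplus> z = z \<oplus> a"
  using z by (simp add: centralizer_def)

lemma central_left_commute:
  assumes "a \<in> carrier B" "b \<in> carrier B" shows "a \<oplus> (z \<oplus> b) = z \<oplus> (a \<oplus> b)"
proof -
  have "(a \<oplus> z) \<oplus> b = (z \<oplus> a) \<oplus> b"
    using assms by (simp only: central_commute)
  then show ?thesis
    using assms central_mem by simp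
qed

end

lemma add_star_central:
  assumes [simp]: "a \<in> carrier B" "b \<in> carrier B" and z: "z \<in> centralizer (carrier B)"
  shows "(a \<oplus> b) \<star> z = a \<star> z \<oplus> b \<star> z"
  using central_mem[OF z] central_left_commute[OF central_star[OF z], of a "\<ominus> b" "b \<oplus> b \<star> z"]
  by (simp add: star_add_left)

lemma central_star_add:
  assumes [simp]: "a \<in> carrier B" "b \<in> carrier B" and z: "z \<in> centralizer (carrier B)"
  shows "z \<star> (a \<oplus> b) = z \<star> a \<oplus> z \<star> b"
  using central_mem[OF z] central_left_commute[OF star_central[OF z], of b a "\<ominus> a"]
  by (simp add: star_add_right)

text \<open>Compare two expansions of \<open>(a \<otimes> b) \<star> z\<close>, as for a module over
  a ring; star products with \<open>z\<close> are central and can be reordered.\<close>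

lemma star_star_central:
  assumes [simp]: "a \<in> carrier B" "b \<in> carrier B" and z: "z \<in> centralizer (carrier B)"
  shows "(a \<star> b) \<star> z = a \<star> (b \<star> z)"
proof -
  have [simp]: "z \<in> carrier B"
    by (rule central_mem[OF z])
  have "a \<star> z \<oplus> ((a \<star> b) \<star> z \<oplus> b \<star> z) = (a \<otimes> b) \<star> z"
    by (simp add: mult_eq add_star_central z)
  also have "\<dots> = a \<star> z \<oplus> (a \<star> (b \<star> z) \<oplus> b \<star> z)"
    using central_commute[OF central_star[OF z], of a "b \<star> z"]
      central_left_commute[OF central_star[OF z], of a "a \<star> (b \<star> z)" "b \<star> z"]
    by (simp add: star_mult_left)
  finally have "(a \<star> b) \<star> z \<oplus> b \<star> z = a \<star> (b \<star> z) \<oplus> b \<star> z"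
    by simp
  then show ?thesis
    by simp
qed

text \<open>The mirror image, with \<open>rho_mult\<close> in place of
  \<open>star_mult_left\<close>.\<close>

lemma central_star_star:
  assumes [simp]: "a \<in> carrier B" "b \<in> carrier B" and z: "z \<in> centralizer (carrier B)"
  shows "z \<star> (a \<star> b) = (z \<star> a) \<star> b"
proof -
  have [simp]: "z \<in> carrier B"
    by (rule central_mem[OF z])
  have "z \<oplus> z \<star> (a \<otimes> b) = z \<oplus> (z \<star> b \<oplus> (z \<star> a \<oplus> (z \<star> a) \<star> b))"
    using rho_mult[of a b z] by (simp add: rho_eq star_add_left)
  then have "z \<star> a \<oplus> (z \<star> (a \<star> b) \<oplus> z \<star> b) = z \<star> b \<oplus> (z \<star> a \<oplus> (z \<star> a) \<star> b)"
    by (simp add: mult_eq central_star_add z)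
  also have "\<dots> = z \<star> a \<oplus> ((z \<star> a) \<star> b \<oplus> z \<star> b)"
    using central_commute[OF star_central[OF z], of b "(z \<star> a) \<star> b"]
      central_left_commute[OF star_central[OF z], of a "z \<star> b" "(z \<star> a) \<star> b"]
    by simp
  finally have "z \<star> (a \<star> b) \<oplus> z \<star> b = (z \<star> a) \<star> b \<oplus> z \<star> b"
    by simp
  then show ?thesis
    by simp
qed

lemma neg_star_central:
  assumes "a \<in> carrier B" and z: "z \<in> centralizer (carrier B)"
  shows "\<ominus> a \<star> z = \<ominus> (a \<star> z)"
proof -
  have "a \<star> z \<oplus> \<ominus> a \<star> z = a \<star> z \<oplus> \<ominus> (a \<star> z)"
    using assms central_mem[OF z] by (simp flip: add_star_central)
  then show ?thesis
    using assms central_mem[OF z] by (simp del: r_neg)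
qed

lemma central_star_neg:
  assumes "a \<in> carrier B" and z: "z \<in> centralizer (carrier B)"
  shows "z \<star> (\<ominus> a) = \<ominus> (z \<star> a)"
proof -
  have "z \<star> a \<oplus> z \<star> (\<ominus> a) = z \<star> a \<oplus> \<ominus> (z \<star> a)"
    using assms central_mem[OF z] by (simp flip: central_star_add)
  then show ?thesis
    using assms central_mem[OF z] by (simp del: r_neg)
qed

lemma commutator_central_cancel:
  assumes z: "y \<in> centralizer (carrier B)" and "x \<in> carrier B"
  shows "x \<oplus> (y \<oplus> (\<ominus> x \<oplus> \<ominus> y)) = \<zero>"
  using assms central_mem[OF z] central_left_commute[OF z, of x "\<ominus> x \<oplus> \<ominus> y"] by simp

text \<open>
  For additively central \<open>z\<close> the maps \<open>b \<mapsto> b \<star> z\<close> and \<open>b \<mapsto> z \<star> b\<close> are additive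
  with commuting values, so the ideals of elements acting trivially contain all additive
  commutators.
\<close>

lemma perfect_star_central:
  assumes fin: "finite (carrier B)" and perf: "sb_perfect B"
    and a: "a \<in> carrier B" and z: "z \<in> centralizer (carrier B)"
  shows "a \<star> z = \<zero>"
proof -
  let ?Z = "centralizer (carrier B)"
  define K where "K = {k \<in> carrier B. \<forall>z\<in>?Z. k \<star> z = \<zero>}"
  note [simp] = central_mem add_star_central neg_star_central star_star_central
  \<comment> \<open>For absorption, \<open>(c \<star> k) \<star> z = c \<star> (k \<star> z)\<close>
    and \<open>(k \<star> c) \<star> z = k \<star> (c \<star> z)\<close>, where
    \<open>c \<star> z\<close> is again central.\<close>
  have "sb_ideal K B"
    by (rule sb_idealI) (auto simp: K_def intro: central_star)
  then have "K = carrier B"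
    by (rule perfect_ideal_abelian_quotient[OF fin perf])
      (auto simp: K_def commutator_central_cancel central_star)
  then show ?thesis
    using a z by (auto simp: K_def)
qed

lemma perfect_central_star:
  assumes fin: "finite (carrier B)" and perf: "sb_perfect B"
    and a: "a \<in> carrier B" and z: "z \<in> centralizer (carrier B)"
  shows "z \<star> a = \<zero>"
proof -
  let ?Z = "centralizer (carrier B)"
  define K where "K = {k \<in> carrier B. \<forall>z\<in>?Z. z \<star> k = \<zero>}"
  note [simp] = central_mem central_star_add central_star_neg central_star_star
  have "sb_ideal K B"
    by (rule sb_idealI) (auto simp: K_def intro: star_central)
  then have "K = carrier B"
    by (rule perfect_ideal_abelian_quotient[OF fin perf])
      (auto simp: K_def commutator_central_cancel star_central)
  then show ?thesis
    using a z by (auto simp: K_def)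
qed

lemma perfect_center_eq:
  assumes "finite (carrier B)" "sb_perfect B"
  shows "sb_center B = centralizer (carrier B)"
proof
  show "centralizer (carrier B) \<subseteq> sb_center B"
  proof
    fix z assume z: "z \<in> centralizer (carrier B)"
    then have [simp]: "z \<in> carrier B"
      by (rule central_mem)
    have "z \<oplus> a = a \<oplus> z \<and> z \<otimes> a = a \<otimes> z \<and> sb_lambda B z a = a" if [simp]: "a \<in> carrier B" for a
      using perfect_star_central[OF assms _ z, of a] perfect_central_star[OF assms _ z, of a]
        central_commute[OF z, of a]
      by (simp add: mult_eq lambda_eq)
    then show "z \<in> sb_center B"
      by (simp add: sb_center_def)
  qed
qed (auto simp: sb_center_def centralizer_def)

subsection \<open>The quotient by the center\<close>

text \<open>The alternative in \<open>fadd\<close> covers both factors, \<open>Triv\<close> and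
  \<open>aTriv\<close>. After passing to the abelianization of \<open>G\<close> the order of factors
  is irrelevant, so both operations of \<open>B\<close> induce the same commutative one. The kernel
  \<open>J\<close> then contains all star products and additive commutators, and perfectness makes
  it everything.\<close>

lemma perfect_hom_image:
  assumes perf: "sb_perfect B" and "group G" and f: "f \<in> hom B G"
    and surj: "f ` carrier B = carrier G"
    and fadd: "(\<forall>a\<in>carrier B. \<forall>b\<in>carrier B. f (a \<oplus> b) = f a \<otimes>\<^bsub>G\<^esub> f b) \<or>
      (\<forall>a\<in>carrier B. \<forall>b\<in>carrier B. f (a \<oplus> b) = f b \<otimes>\<^bsub>G\<^esub> f a)"
  shows "perfect_group G"
proof -
  interpret G: group G by fact
  interpret f: group_hom B G f
    by unfold_locales (rule f)
  let ?D = "derived G (carrier G)"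
  interpret D: normal ?D G
    by (rule G.derived_self_is_normal)
  have fcl [simp]: "f x \<in> carrier G" if "x \<in> carrier B" for x
    using that by (rule f.hom_closed)
  have comm: "x \<otimes>\<^bsub>G\<^esub> y \<otimes>\<^bsub>G\<^esub> inv\<^bsub>G\<^esub> x \<otimes>\<^bsub>G\<^esub> inv\<^bsub>G\<^esub> y \<in> ?D" if "x \<in> carrier G" "y \<in> carrier G" for x y
    unfolding derived_def using that by (intro generate.incl) auto
  define p where "p x = ?D #>\<^bsub>G\<^esub> f x" for x
  define A where "A = G Mod ?D"
  interpret Q: comm_group A
    unfolding A_def by (rule G.derived_quot_is_comm_group)
  have proj: "(\<lambda>x. ?D #>\<^bsub>G\<^esub> x) \<in> hom G A"
    unfolding A_def by (rule D.r_coset_hom_Mod)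
  have p_hom: "p (a \<otimes> b) = p a \<otimes>\<^bsub>A\<^esub> p b" and p_add: "p (a \<oplus> b) = p a \<otimes>\<^bsub>A\<^esub> p b"
    and pcl [simp]: "p a \<in> carrier (A)"
    if ab: "a \<in> carrier B" "b \<in> carrier B" for a b
  proof -
    have h: "?D #>\<^bsub>G\<^esub> (f x \<otimes>\<^bsub>G\<^esub> f y) = p x \<otimes>\<^bsub>A\<^esub> p y" if "x \<in> carrier B" "y \<in> carrier B" for x y
      using hom_mult[OF proj, of "f x" "f y"] that by (simp add: p_def)
    have cl: "p x \<in> carrier (A)" if "x \<in> carrier B" for x
      using hom_in_carrier[OF proj, of "f x"] that by (simp add: p_def)
    show "p a \<in> carrier (A)" "p (a \<otimes> b) = p a \<otimes>\<^bsub>A\<^esub> p b"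
      using ab h[of a b] cl by (auto simp: p_def)
    show "p (a \<oplus> b) = p a \<otimes>\<^bsub>A\<^esub> p b"
      using fadd ab h[of a b] h[of b a] cl Q.m_comm[of "p a" "p b"] by (auto simp: p_def)
  qed
  have p_one: "p x = \<one>\<^bsub>A\<^esub> \<longleftrightarrow> f x \<in> ?D" if "x \<in> carrier B" for x
    using that G.coset_join1[of ?D "f x"] G.coset_join2[of "f x" ?D] D.subgroup_axioms D.subset
    by (auto simp: p_def A_def FactGroup_def)
  define J where "J = {x \<in> carrier B. p x = \<one>\<^bsub>A\<^esub>}"
  have p_zero: "p \<zero> = \<one>\<^bsub>A\<^esub>"
    using p_one[of \<one>] D.one_closed by (simp add: zero_eq_one)
  have p_neg: "p (\<ominus> x) = inv\<^bsub>A\<^esub> p x" if "x \<in> carrier B" for x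
    using that p_add[of "\<ominus> x" x] p_zero pcl by (intro Q.inv_equality[symmetric]) auto
  note [simp] = p_hom p_add p_zero p_neg
  have p_star: "p (a \<star> b) = \<one>\<^bsub>A\<^esub>" if [simp]: "a \<in> carrier B" "b \<in> carrier B" for a b
    using pcl[of a a] pcl[of b b] by (simp add: star_def Q.m_assoc)
  have J: "sb_ideal J B"
  proof (rule sb_idealI)
    fix c x assume "c \<in> carrier B" "x \<in> J"
    then show "c \<oplus> (x \<oplus> \<ominus> c) \<in> J"
      using pcl[of c c] by (simp add: J_def)
  qed (auto simp: J_def p_star)
  have "J = carrier B"
  proof (rule perfect_ideal_eq_carrier[OF J perf])
    fix a b assume ab [simp]: "a \<in> carrier B" "b \<in> carrier B"
    show "a \<star> b \<in> J"
      by (simp add: J_def p_star)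
    have "p a \<otimes>\<^bsub>A\<^esub> (p b \<otimes>\<^bsub>A\<^esub> (inv\<^bsub>A\<^esub> p a \<otimes>\<^bsub>A\<^esub> inv\<^bsub>A\<^esub> p b)) = \<one>\<^bsub>A\<^esub>"
      using pcl[OF ab(1,1)] pcl[OF ab(2,2)] Q.m_lcomm[of "p b" "inv\<^bsub>A\<^esub> p a" "inv\<^bsub>A\<^esub> p b"]
      by simp
    then show "a \<oplus> (b \<oplus> (\<ominus> a \<oplus> \<ominus> b)) \<in> J"
      by (simp add: J_def)
  qed
  then have "f x \<in> ?D" if "x \<in> carrier B" for x
    using that p_one[OF that] by (auto simp: J_def)
  then have "carrier G \<subseteq> ?D"
    by (auto simp flip: surj)
  then have "?D = carrier G"
    using D.subset by auto
  then show ?thesis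
    by (simp add: perfect_group_def G.group_axioms)
qed

text \<open>A first isomorphism theorem for bare records. By \<open>ker\<close> the cosets of
  \<open>Z\<close> are the fibres of \<open>F\<close>, so independence of representatives follows
  from \<open>F\<close> respecting both operations.\<close>

lemma Quot_iso:
  fixes S (structure)
  assumes Z: "Z \<lhd> add_monoid B"
    and cl: "\<And>x. x \<in> carrier B \<Longrightarrow> F x \<in> carrier S"
    and add: "\<And>x y. \<lbrakk>x \<in> carrier B; y \<in> carrier B\<rbrakk> \<Longrightarrow> F (x \<oplus> y) = F x \<oplus>\<^bsub>S\<^esub> F y"
    and mult: "\<And>x y. \<lbrakk>x \<in> carrier B; y \<in> carrier B\<rbrakk> \<Longrightarrow> F (x \<otimes> y) = F x \<otimes>\<^bsub>S\<^esub> F y"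
    and one: "F \<one> = \<one>\<^bsub>S\<^esub>"
    and surj: "carrier S \<subseteq> F ` carrier B"
    and ker: "\<And>x y. \<lbrakk>x \<in> carrier B; y \<in> carrier B\<rbrakk> \<Longrightarrow> F x = F y \<longleftrightarrow> x \<oplus> \<ominus> y \<in> Z"
  shows "B Quot Z \<simeq> S"
proof -
  have sub: "Z \<subseteq> carrier B"
    using subgroup.subset[OF normal_imp_subgroup[OF Z]] by simp
  have coset: "Z +> x = {y \<in> carrier B. F y = F x}" if [simp]: "x \<in> carrier B" for x
  proof -
    have iff: "y \<in> Z +> x \<longleftrightarrow> (\<exists>z\<in>Z. y = z \<oplus> x)" for y
      by (auto simp: a_r_coset_def r_coset_def)
    have "y \<in> Z +> x" if [simp]: "y \<in> carrier B" and y: "y \<oplus> \<ominus> x \<in> Z" for y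
      unfolding iff by (rule bexI[OF _ y]) simp
    moreover have "y \<in> carrier B \<and> y \<oplus> \<ominus> x \<in> Z" if "y \<in> Z +> x" for y
      using that sub unfolding iff by auto
    ultimately show ?thesis
      using ker[OF _ that] by blast
  qed
  have carr: "carrier (B Quot Z) = (\<lambda>x. Z +> x) ` carrier B"
    by (auto simp: FactRing_def A_RCOSETS_def RCOSETS_def a_r_coset_def)
  have qmult: "(Z +> x) \<otimes>\<^bsub>B Quot Z\<^esub> (Z +> y) = Z +> (x \<otimes> y)"
    if [simp]: "x \<in> carrier B" "y \<in> carrier B" for x y
  proof -
    \<comment> \<open>\<open>rcoset_mult\<close> is a union over all pairs of representatives. All
      its members are the same coset, and the index sets are nonempty.\<close>
    have "Z +> (a \<otimes> b) = Z +> (x \<otimes> y)" if "a \<in> Z +> x" "b \<in> Z +> y" for a b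
      using that by (simp add: coset mult)
    then have "rcoset_mult B Z (Z +> x) (Z +> y) = (\<Union>a\<in>Z +> x. \<Union>b\<in>Z +> y. Z +> (x \<otimes> y))"
      unfolding rcoset_mult_def by (intro SUP_cong refl)
    moreover have "x \<in> Z +> x" "y \<in> Z +> y"
      by (simp_all add: coset)
    then have "Z +> x \<noteq> {}" "Z +> y \<noteq> {}"
      by blast+
    ultimately show ?thesis
      by (simp add: FactRing_def)
  qed
  have qadd: "(Z +> x) \<oplus>\<^bsub>B Quot Z\<^esub> (Z +> y) = Z +> (x \<oplus> y)"
    if [simp]: "x \<in> carrier B" "y \<in> carrier B" for x y
    using normal.rcos_sum[OF Z, of x y] by (simp add: FactRing_def set_add_def a_r_coset_def)
  have qone: "\<one>\<^bsub>B Quot Z\<^esub> = Z +> \<one>"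
    by (simp add: FactRing_def)
  define h where "h X = the_elem (F ` X)" for X
  have h: "h (Z +> x) = F x" if [simp]: "x \<in> carrier B" for x
  proof -
    have "x \<in> Z +> x" "\<And>y. y \<in> Z +> x \<Longrightarrow> F y = F x"
      by (simp_all add: coset)
    then have "F ` (Z +> x) = {F x}"
      by blast
    then show ?thesis
      by (simp add: h_def)
  qed
  have "h \<in> ring_hom (B Quot Z) S"
    by (rule ring_hom_memI) (auto simp: carr h qmult qadd qone cl mult add one)
  moreover have "bij_betw h (carrier (B Quot Z)) (carrier S)"
    unfolding bij_betw_def
  proof
    show "inj_on h (carrier (B Quot Z))"
    proof (rule inj_onI)
      fix X Y assume "X \<in> carrier (B Quot Z)" "Y \<in> carrier (B Quot Z)" and eq: "h X = h Y"
      then obtain x y where [simp]: "x \<in> carrier B" "y \<in> carrier B" and XY: "X = Z +> x" "Y = Z +> y"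
        by (auto simp: carr)
      have "F x = F y"
        using eq by (simp add: XY h)
      then show "X = Y"
        by (simp add: XY coset)
    qed
    show "h ` carrier (B Quot Z) = carrier S"
    proof
      show "h ` carrier (B Quot Z) \<subseteq> carrier S"
        by (auto simp: carr h cl)
      have "F ` carrier B \<subseteq> h ` carrier (B Quot Z)"
        by (auto simp: carr h image_image)
      then show "carrier S \<subseteq> h ` carrier (B Quot Z)"
        using surj by blast
    qed
  qed
  ultimately show ?thesis
    by (auto simp: is_ring_iso_def ring_iso_def)
qed

text \<open>The coordinates of the final map are multiplicative cosets, whereas membership in the
  two ideals is known for additive differences.\<close>

lemma ideal_coset_eq_iff:
  assumes J: "sb_ideal J B" and [simp]: "x \<in> carrier B" "y \<in> carrier B"
  shows "J #> x = J #> y \<longleftrightarrow> x \<oplus> \<ominus> y \<in> J"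
proof -
  have sub: "subgroup J B"
    by (rule normal_imp_subgroup[OF ideal_normal_mult[OF J]])
  have "J #> x = J #> y \<longleftrightarrow> x \<otimes> inv y \<in> J"
  proof
    assume "J #> x = J #> y"
    then have "x \<in> J #> y"
      using rcos_self[OF _ sub, of x] by simp
    then show "x \<otimes> inv y \<in> J"
      using subgroup.subset[OF sub] by (auto simp: r_coset_def m_assoc subset_iff)
  next
    assume j: "x \<otimes> inv y \<in> J"
    have "x = (x \<otimes> inv y) \<otimes> y"
      by (simp add: m_assoc)
    then have "x \<in> J #> y"
      using j by (auto simp: r_coset_def)
    then show "J #> x = J #> y"
      using repr_independence[OF _ _ sub, of x y] by simp
  qed
  then show ?thesis
    using ideal_minus_iff_divide[OF J] by simp
qed

end

theorem corollary3:
  fixes B :: "('a, 'm) ring_scheme"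
  assumes "two_sided_skew_brace B"
    and "finite (carrier B)"
    and "sb_perfect B"
  shows "\<exists>(G :: 'a set monoid) (H :: 'a set monoid).
    perfect_group G \<and> finite (carrier G) \<and>
    perfect_group H \<and> finite (carrier H) \<and>
    B Quot sb_center B \<simeq> RDirProd (Triv G) (aTriv H)"
proof -
  interpret two_sided_skew_brace B by fact
  define I where "I = centralizer ostars"
  define J where "J = centralizer stars"
  have I: "sb_ideal I B" and J: "sb_ideal J B"
    unfolding I_def J_def by (rule centralizer_ostars_ideal centralizer_stars_ideal)+
  have Int: "I \<inter> J = sb_center B"
    using perfect_centralizers_Int perfect_center_eq assms by (simp add: I_def J_def)
  have sum: "set_add B I J = carrier B"
    using perfect_centralizers_sum assms by (simp add: I_def J_def)
  let ?G = "B Mod I" and ?H = "B Mod J"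
  let ?g = "\<lambda>x. I #>\<^bsub>B\<^esub> x" and ?h = "\<lambda>x. J #>\<^bsub>B\<^esub> x"
  interpret I: normal I B by (rule ideal_normal_mult[OF I])
  interpret J: normal J B by (rule ideal_normal_mult[OF J])
  have carr: "carrier ?G = ?g ` carrier B" "carrier ?H = ?h ` carrier B"
    by (auto simp: FactGroup_def RCOSETS_def)
  have mult: "?g (x \<otimes>\<^bsub>B\<^esub> y) = ?g x \<otimes>\<^bsub>?G\<^esub> ?g y" "?h (x \<otimes>\<^bsub>B\<^esub> y) = ?h x \<otimes>\<^bsub>?H\<^esub> ?h y"
    if "x \<in> carrier B" "y \<in> carrier B" for x y
    using that hom_mult[OF I.r_coset_hom_Mod] hom_mult[OF J.r_coset_hom_Mod] by blast+
  have "?g (x \<oplus>\<^bsub>B\<^esub> y) = ?g (x \<otimes>\<^bsub>B\<^esub> y)" if [simp]: "x \<in> carrier B" "y \<in> carrier B" for x y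
  proof -
    \<comment> \<open>This element is the additive difference of \<open>x \<oplus> y\<close> and
      \<open>x \<otimes> y\<close>.\<close>
    have "x \<oplus>\<^bsub>B\<^esub> (\<ominus>\<^bsub>B\<^esub> (x \<star> y) \<oplus>\<^bsub>B\<^esub> \<ominus>\<^bsub>B\<^esub> x) \<in> I"
      unfolding I_def
      by (intro ideal_conj[OF centralizer_ostars_ideal] ideal_neg[OF centralizer_ostars_ideal]
          star_in_centralizer_ostars that)
    then show ?thesis
      by (simp add: ideal_coset_eq_iff[OF I] mult_eq)
  qed
  then have gadd: "?g (x \<oplus>\<^bsub>B\<^esub> y) = ?g x \<otimes>\<^bsub>?G\<^esub> ?g y" if "x \<in> carrier B" "y \<in> carrier B" for x y
    using that mult by simp
  have "?h (x \<oplus>\<^bsub>B\<^esub> y) = ?h (y \<otimes>\<^bsub>B\<^esub> x)" if [simp]: "x \<in> carrier B" "y \<in> carrier B" for x y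
  proof -
    \<comment> \<open>Here it is the difference of \<open>x \<oplus> y\<close> and
      \<open>y \<otimes> x\<close>, with reversed factors; this produces the \<open>aTriv\<close>
      factor.\<close>
    have "x \<oplus>\<^bsub>B\<^esub> (\<ominus>\<^bsub>B\<^esub> (y \<diamondop> x) \<oplus>\<^bsub>B\<^esub> \<ominus>\<^bsub>B\<^esub> x) \<in> J"
      unfolding J_def
      by (intro ideal_conj[OF centralizer_stars_ideal] ideal_neg[OF centralizer_stars_ideal]
          ostar_in_centralizer_stars that)
    then show ?thesis
      by (simp add: ideal_coset_eq_iff[OF J] ostar_def)
  qed
  then have hadd: "?h (x \<oplus>\<^bsub>B\<^esub> y) = ?h y \<otimes>\<^bsub>?H\<^esub> ?h x" if "x \<in> carrier B" "y \<in> carrier B" for x y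
    using that mult by simp
  have "perfect_group ?G"
    using gadd
    by (intro perfect_hom_image[OF assms(3) I.factorgroup_is_group I.r_coset_hom_Mod]) (auto simp: carr)
  moreover have "perfect_group ?H"
    using hadd
    by (intro perfect_hom_image[OF assms(3) J.factorgroup_is_group J.r_coset_hom_Mod]) (auto simp: carr)
  moreover have "finite (carrier ?G)" "finite (carrier ?H)"
    using assms(2) by (simp_all add: carr)
  moreover have "B Quot sb_center B \<simeq> RDirProd (Triv ?G) (aTriv ?H)"
  proof (rule Quot_iso[where F = "\<lambda>x. (?g x, ?h x)"])
    have "sb_ideal (sb_center B) B"
      using ideal_Int[OF I J] by (simp add: Int)
    then show "sb_center B \<lhd> add_monoid B"
      by (rule ideal_normal_add)
    show "carrier (RDirProd (Triv ?G) (aTriv ?H)) \<subseteq> (\<lambda>x. (?g x, ?h x)) ` carrier B"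
    proof
      fix u assume "u \<in> carrier (RDirProd (Triv ?G) (aTriv ?H))"
      then obtain a b where [simp]: "a \<in> carrier B" "b \<in> carrier B" and u: "u = (?g a, ?h b)"
        by (auto simp: RDirProd_carrier Triv_def aTriv_def carr)
      \<comment> \<open>Chinese remaindering: if
        \<open>\<ominus> a \<oplus> b = i \<oplus> j\<close>, then \<open>a \<oplus> i\<close>
        equals \<open>b \<oplus> \<ominus> j\<close>, so it is congruent to \<open>a\<close> modulo
        \<open>I\<close> and to \<open>b\<close> modulo \<open>J\<close>.\<close>
      have "\<ominus>\<^bsub>B\<^esub> a \<oplus>\<^bsub>B\<^esub> b \<in> set_add B I J"
        by (simp add: sum)
      then obtain i j where i: "i \<in> I" and j: "j \<in> J" and ij: "\<ominus>\<^bsub>B\<^esub> a \<oplus>\<^bsub>B\<^esub> b = i \<oplus>\<^bsub>B\<^esub> j"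
        by (auto simp: set_add_def set_mult_def)
      note [simp] = ideal_mem[OF I i] ideal_mem[OF J j]
      let ?x = "a \<oplus>\<^bsub>B\<^esub> i"
      have b: "b = ?x \<oplus>\<^bsub>B\<^esub> j"
        using arg_cong[OF ij, of "\<lambda>t. a \<oplus>\<^bsub>B\<^esub> t"] by simp
      have "?g ?x = ?g a"
        using ideal_conj[OF I _ i, of a] by (simp add: ideal_coset_eq_iff[OF I])
      moreover have "?h ?x = ?h b"
        using ideal_conj[OF J _ ideal_neg[OF J j], of ?x]
        by (simp add: ideal_coset_eq_iff[OF J] b)
      ultimately show "u \<in> (\<lambda>x. (?g x, ?h x)) ` carrier B"
        by (auto simp: u intro!: image_eqI[of _ _ ?x])
    qed
    show "(?g x, ?h x) = (?g y, ?h y) \<longleftrightarrow> x \<oplus>\<^bsub>B\<^esub> \<ominus>\<^bsub>B\<^esub> y \<in> sb_center B"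
      if "x \<in> carrier B" "y \<in> carrier B" for x y
      using that by (simp add: ideal_coset_eq_iff[OF I] ideal_coset_eq_iff[OF J] flip: Int)
    have "?g \<one>\<^bsub>B\<^esub> = I" "?h \<one>\<^bsub>B\<^esub> = J"
      using coset_mult_one[OF I.subset] coset_mult_one[OF J.subset] by auto
    then show "(?g \<one>\<^bsub>B\<^esub>, ?h \<one>\<^bsub>B\<^esub>) = \<one>\<^bsub>RDirProd (Triv ?G) (aTriv ?H)\<^esub>"
      by (simp add: RDirProd_def DirProd_def monoid.defs Triv_def aTriv_def FactGroup_def)
  qed (auto simp: RDirProd_def DirProd_def monoid.defs Triv_def aTriv_def carr mult gadd hadd)
  ultimately show ?thesis
    by blast
qed

end
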